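(* For all $f_1,\dots,f_{n-2}\in C^\infty(\Sigma)$ and $A=1,\dots,p$ it holds that $$\gamma^2\,\mathcal C_A(f_1,\dots,f_{n-2})=(\mathcal P^2)^i_j\Big[\{x^k,\bar\Gamma^j_{kj'}\}_f-\{x^k,x^l\}_f\,\bar\Gamma^r_{lj'}\bar\Gamma^j_{kr}\Big]n_A^{j'}\partial_i,$$ where $\{g_1,g_2\}_f=\{g_1,g_2,f_1,\dots,f_{n-2}\}$.
   Context: Setting: $n\ge2$, $p\ge1$, $m=n+p$; $\Sigma$ is an $n$-dimensional manifold embedded in an $m$-dimensional Riemannian manifold $(M,\bar g)$, with the induced metric. Local coordinates on $M$ are $x^1,\dots,x^m$, on $\Sigma$ they are $u^1,\dots,u^n$, and the $x^i$ are regarded as functions of the $u^a$ giving the embedding. Repeated indices are summed (ambient indices $1,\dots,m$; indices $a,b,\dots$ from $1$ to $n$). $\partial_a=\partial/\partial u^a$, $\partial_i=\partial/\partial x^i$, $e_a=(\partial_ax^i)\partial_i$, $g_{ab}=\bar g(e_a,e_b)$, $g=\det(g_{ab})$. $N_A=n_A^i\partial_i$, $A=1,\dots,p$, is a local orthonormal frame of the normal bundle. $\bar\nabla$ and $\bar\Gamma^i_{jk}$ are the Levi-Civita connection and Christoffel symbols of $M$ (the latter restricted to $\Sigma$, hence functions on $\Sigma$), $\nabla$ is the Levi-Civita connection of $\Sigma$. Weingarten maps $W_A:T\Sigma\to T\Sigma$ and the normal connection $D$ are defined by $\bar\nabla_XN_A=-W_A(X)+D_XN_A$ (tangential and normal parts).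 For $X,Y\in T\Sigma$ set $$\mathcal W_A(X,Y)=(\nabla_XW_A)(Y)-(\nabla_YW_A)(X)+\sum_{B=1}^p\Big[\bar g(D_XN_B,N_A)W_B(Y)-\bar g(D_YN_B,N_A)W_B(X)\Big].$$ Let $\rho$ be an arbitrary non-vanishing density on $\Sigma$, $\gamma=\sqrt g/\rho$, and define the Nambu bracket $\{f_1,\dots,f_n\}=\frac1\rho\varepsilon^{a_1\cdots a_n}(\partial_{a_1}f_1)\cdots(\partial_{a_n}f_n)$ ($\varepsilon$ the Levi-Civita symbol). The maps $\mathcal C_A:C^\infty(\Sigma)\times\cdots\times C^\infty(\Sigma)\to T\Sigma$ are $$\mathcal C_A(f_1,\dots,f_{n-2})=\frac1{2\rho}\varepsilon^{aba_1\cdots a_{n-2}}\mathcal W_A(e_a,e_b)(\partial_{a_1}f_1)\cdots(\partial_{a_{n-2}}f_{n-2})\quad(n\ge3),$$ and $\mathcal C_A=\frac1{2\rho}\varepsilon^{ab}\mathcal W_A(e_a,e_b)$ when $n=2$ (in which case there are no $f$'s and $\{g_1,g_2\}_f=\{g_1,g_2\}$). With multi-indices $I=i_1\cdots i_{n-1}$, $J=j_1\cdots j_{n-1}$, $\bar g_{IJ}=\bar g_{i_1j_1}\cdots\bar g_{i_{n-1}j_{n-1}}$, set $\mathcal P^{iJ}=\frac1{\sqrt{(n-1)!}}\{x^i,x^{j_1},\dots,x^{j_{n-1}}\}$, $(\mathcal P^2)^{ik}=\mathcal P^{iI}\mathcal P^{kJ}\bar g_{IJ}$ and $(\mathcal P^2)^i_j=(\mathcal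 P^2)^{ik}\bar g_{kj}$. *)

theory Defs
  imports "HOL-Analysis.Analysis" "HOL-Combinatorics.Permutations"
begin

section \<open>Smooth functions on open sets\<close>

text \<open>The set is meant to be open; directional derivatives in all directions are iterated.\<close>

fun Ck_on :: "nat \<Rightarrow> 'a::real_normed_vector set \<Rightarrow> ('a \<Rightarrow> 'b::real_normed_vector) \<Rightarrow> bool" where
  "Ck_on 0 U f \<longleftrightarrow> continuous_on U f"
| "Ck_on (Suc k) U f \<longleftrightarrow> (\<forall>x\<in>U. f differentiable (at x)) \<and>
      (\<forall>v. Ck_on k U (\<lambda>x. frechet_derivative f (at x) v))"

definition smooth_on :: "'a::real_normed_vector set \<Rightarrow> ('a \<Rightarrow> 'b::real_normed_vector) \<Rightarrow> bool" where
  "smooth_on U f \<longleftrightarrow> (\<forall>k. Ck_on k U f)"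

definition partial :: "'d::finite \<Rightarrow> (real^'d \<Rightarrow> 'b::real_normed_vector) \<Rightarrow> real^'d \<Rightarrow> 'b" where
  "partial a f u = frechet_derivative f (at u) (axis a 1)"


section \<open>Smooth manifolds, Riemannian metrics, embeddings\<close>

text \<open>A chart is a pair of its domain and its coordinate map.  The dimension is the cardinality
  of the index type of the coordinates.\<close>

type_synonym ('a, 'd) chart = "'a set \<times> ('a \<Rightarrow> real^'d)"

definition chart_image :: "('a, 'd::finite) chart \<Rightarrow> (real^'d) set" where
  "chart_image c = snd c ` fst c"

definition chart_inv :: "('a, 'd::finite) chart \<Rightarrow> real^'d \<Rightarrow> 'a" where
  "chart_inv c = the_inv_into (fst c) (snd c)"

definition is_chart :: "'a topology \<Rightarrow> ('a, 'd::finite) chart \<Rightarrow> bool" where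
  "is_chart X c \<longleftrightarrow> openin X (fst c) \<and> open (chart_image c) \<and>
     homeomorphic_map (subtopology X (fst c)) (top_of_set (chart_image c)) (snd c)"

definition coord_rep ::
  "('a, 'd::finite) chart \<Rightarrow> ('b, 'e::finite) chart \<Rightarrow> ('a \<Rightarrow> 'b) \<Rightarrow> real^'d \<Rightarrow> real^'e" where
  "coord_rep c d F = snd d \<circ> F \<circ> chart_inv c"

definition compatible :: "('a, 'd::finite) chart \<Rightarrow> ('a, 'd) chart \<Rightarrow> bool" where
  "compatible c d \<longleftrightarrow>
     smooth_on (snd c ` (fst c \<inter> fst d)) (coord_rep c d id) \<and>
     smooth_on (snd d ` (fst c \<inter> fst d)) (coord_rep d c id)"

text \<open>The atlas of a manifold is required to be maximal, so that its elements are exactly the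
  local coordinate systems.\<close>

definition smooth_manifold :: "'a topology \<Rightarrow> ('a, 'd::finite) chart set \<Rightarrow> bool" where
  "smooth_manifold X \<A> \<longleftrightarrow>
     Hausdorff_space X \<and> second_countable X \<and>
     topspace X = (\<Union>c\<in>\<A>. fst c) \<and>
     (\<forall>c\<in>\<A>. is_chart X c) \<and>
     (\<forall>c\<in>\<A>. \<forall>d\<in>\<A>. compatible c d) \<and>
     (\<forall>c. is_chart X c \<and> (\<forall>d\<in>\<A>. compatible c d) \<longrightarrow> c \<in> \<A>)"

definition smooth_function :: "('a, 'd::finite) chart set \<Rightarrow> ('a \<Rightarrow> real) \<Rightarrow> bool" where
  "smooth_function \<A> f \<longleftrightarrow> (\<forall>c\<in>\<A>. smooth_on (chart_image c) (f \<circ> chart_inv c))"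

text \<open>A Riemannian metric is given by its component matrix in every chart, as a function of the
  coordinates; components in overlapping charts are related by the tensor transformation law.\<close>

definition riemannian_metric ::
  "('a, 'd::finite) chart set \<Rightarrow> (('a, 'd) chart \<Rightarrow> real^'d \<Rightarrow> real^'d^'d) \<Rightarrow> bool" where
  "riemannian_metric \<A> G \<longleftrightarrow>
     (\<forall>c\<in>\<A>. smooth_on (chart_image c) (G c) \<and>
        (\<forall>z\<in>chart_image c. transpose (G c z) = G c z \<and>
           (\<forall>v. v \<noteq> 0 \<longrightarrow> v \<bullet> (G c z *v v) > 0))) \<and>
     (\<forall>c\<in>\<A>. \<forall>d\<in>\<A>. \<forall>z\<in>snd c ` (fst c \<inter> fst d).
        (let J = matrix (frechet_derivative (coord_rep c d id) (at z))
         in G c z = transpose J ** G d (coord_rep c d id z) ** J))"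

definition smooth_embedding ::
  "'s topology \<Rightarrow> ('s, 'n::finite) chart set \<Rightarrow> 'q topology \<Rightarrow> ('q, 'm::finite) chart set \<Rightarrow>
   ('s \<Rightarrow> 'q) \<Rightarrow> bool" where
  "smooth_embedding S \<B> M \<A> \<iota> \<longleftrightarrow>
     embedding_map S M \<iota> \<and>
     (\<forall>c\<in>\<B>. \<forall>d\<in>\<A>. let U = snd c ` (fst c \<inter> \<iota> -` fst d) in
        smooth_on U (coord_rep c d \<iota>) \<and>
        (\<forall>u\<in>U. inj (frechet_derivative (coord_rep c d \<iota>) (at u))))"


section \<open>Submanifold geometry in local coordinates\<close>

text \<open>Below, \<open>G\<close> is the component matrix of the ambient metric as a function of the ambient
  coordinates, \<open>x\<close> expresses the ambient coordinates of points of the submanifold as functions of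
  the submanifold coordinates \<open>u\<close>, and vector fields are functions of \<open>u\<close>: a tangent field of the
  submanifold by its components with respect to the frame \<open>e\<^sub>a\<close>, an ambient field along the
  submanifold by its components with respect to the ambient coordinate frame.\<close>

definition metric_inner :: "real^'d^'d \<Rightarrow> real^'d \<Rightarrow> real^'d \<Rightarrow> real" where
  "metric_inner g v w = (\<Sum>i\<in>UNIV. \<Sum>j\<in>UNIV. g $ i $ j * v $ i * w $ j)"

text \<open>\<open>christoffel G i j k\<close> is the symbol with upper index \<open>i\<close> and lower indices \<open>j\<close>, \<open>k\<close>.\<close>

definition christoffel ::
  "(real^'d \<Rightarrow> real^'d^'d) \<Rightarrow> 'd::finite \<Rightarrow> 'd \<Rightarrow> 'd \<Rightarrow> real^'d \<Rightarrow> real" where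
  "christoffel G i j k z = (1/2) * (\<Sum>l\<in>UNIV. matrix_inv (G z) $ i $ l *
      (partial j (\<lambda>y. G y $ l $ k) z + partial k (\<lambda>y. G y $ l $ j) z
       - partial l (\<lambda>y. G y $ j $ k) z))"

definition tangent_frame :: "(real^'n \<Rightarrow> real^'m) \<Rightarrow> 'n::finite \<Rightarrow> real^'n \<Rightarrow> real^'m" where
  "tangent_frame x a u = (\<chi> i. partial a (\<lambda>v. x v $ i) u)"

definition push_tangent :: "(real^'n::finite \<Rightarrow> real^'m) \<Rightarrow> real^'n \<Rightarrow> real^'n \<Rightarrow> real^'m" where
  "push_tangent x u t = (\<Sum>a\<in>UNIV. t $ a *\<^sub>R tangent_frame x a u)"

definition induced_metric ::
  "(real^'m \<Rightarrow> real^'m^'m) \<Rightarrow> (real^'n \<Rightarrow> real^'m) \<Rightarrow> real^'n \<Rightarrow> real^'n^'n::finite" where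
  "induced_metric G x u =
     (\<chi> a b. metric_inner (G (x u)) (tangent_frame x a u) (tangent_frame x b u))"

definition is_normal ::
  "(real^'m \<Rightarrow> real^'m^'m) \<Rightarrow> (real^'n::finite \<Rightarrow> real^'m) \<Rightarrow> real^'n \<Rightarrow> real^'m \<Rightarrow> bool" where
  "is_normal G x u v \<longleftrightarrow> (\<forall>a. metric_inner (G (x u)) v (tangent_frame x a u) = 0)"

definition tangential_part ::
  "(real^'m \<Rightarrow> real^'m^'m) \<Rightarrow> (real^'n::finite \<Rightarrow> real^'m) \<Rightarrow> real^'n \<Rightarrow> real^'m \<Rightarrow> real^'n" where
  "tangential_part G x u v = (THE t. is_normal G x u (v - push_tangent x u t))"

definition normal_part ::
  "(real^'m \<Rightarrow> real^'m^'m) \<Rightarrow> (real^'n::finite \<Rightarrow> real^'m) \<Rightarrow> real^'n \<Rightarrow> real^'m \<Rightarrow> real^'m" where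
  "normal_part G x u v = v - push_tangent x u (tangential_part G x u v)"

text \<open>An orthonormal frame of the normal bundle over \<open>U\<close>, provided that the codimension is
  \<open>CARD('p)\<close>.\<close>

definition orthonormal_normal_frame ::
  "(real^'m \<Rightarrow> real^'m^'m) \<Rightarrow> (real^'n::finite \<Rightarrow> real^'m) \<Rightarrow> (real^'n) set \<Rightarrow>
   ('p \<Rightarrow> real^'n \<Rightarrow> real^'m) \<Rightarrow> bool" where
  "orthonormal_normal_frame G x U N \<longleftrightarrow>
     (\<forall>A. smooth_on U (N A)) \<and>
     (\<forall>u\<in>U. \<forall>A. is_normal G x u (N A u)) \<and>
     (\<forall>u\<in>U. \<forall>A B. metric_inner (G (x u)) (N A u) (N B u) = (if A = B then 1 else 0))"

text \<open>Levi-Civita derivative of the tangent field \<open>Y\<close> in direction \<open>X\<close>, for a metric \<open>g\<close>.\<close>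

definition levi_civita ::
  "(real^'n \<Rightarrow> real^'n^'n) \<Rightarrow> (real^'n \<Rightarrow> real^'n) \<Rightarrow> (real^'n \<Rightarrow> real^'n) \<Rightarrow>
   real^'n \<Rightarrow> real^'n::finite" where
  "levi_civita g X Y u = (\<chi> c. \<Sum>a\<in>UNIV. X u $ a *
      (partial a (\<lambda>v. Y v $ c) u + (\<Sum>b\<in>UNIV. christoffel g c a b u * Y u $ b)))"

text \<open>Ambient Levi-Civita derivative, in the tangent direction \<open>X\<close>, of an ambient field \<open>V\<close> that
  is defined along the submanifold only.\<close>

definition ambient_deriv ::
  "(real^'m \<Rightarrow> real^'m^'m) \<Rightarrow> (real^'n \<Rightarrow> real^'m) \<Rightarrow> (real^'n \<Rightarrow> real^'n) \<Rightarrow>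
   (real^'n \<Rightarrow> real^'m) \<Rightarrow> real^'n::finite \<Rightarrow> real^'m::finite" where
  "ambient_deriv G x X V u = (\<chi> i. \<Sum>a\<in>UNIV. X u $ a *
      (partial a (\<lambda>v. V v $ i) u +
       (\<Sum>j\<in>UNIV. \<Sum>k\<in>UNIV.
          christoffel G i j k (x u) * partial a (\<lambda>v. x v $ j) u * V u $ k)))"

definition weingarten ::
  "(real^'m::finite \<Rightarrow> real^'m^'m) \<Rightarrow> (real^'n \<Rightarrow> real^'m) \<Rightarrow> (real^'n \<Rightarrow> real^'m) \<Rightarrow>
   (real^'n \<Rightarrow> real^'n) \<Rightarrow> real^'n::finite \<Rightarrow> real^'n" where
  "weingarten G x V X u = - tangential_part G x u (ambient_deriv G x X V u)"

definition normal_connection ::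
  "(real^'m::finite \<Rightarrow> real^'m^'m) \<Rightarrow> (real^'n \<Rightarrow> real^'m) \<Rightarrow> (real^'n \<Rightarrow> real^'n) \<Rightarrow>
   (real^'n \<Rightarrow> real^'m) \<Rightarrow> real^'n::finite \<Rightarrow> real^'m" where
  "normal_connection G x X V u = normal_part G x u (ambient_deriv G x X V u)"

text \<open>The value of \<open>(\<nabla>\<^sub>X W)(Y) = \<nabla>\<^sub>X (W Y) - W (\<nabla>\<^sub>X Y)\<close>, where \<open>W\<close> is the Weingarten map of \<open>V\<close>.\<close>

definition deriv_weingarten ::
  "(real^'m::finite \<Rightarrow> real^'m^'m) \<Rightarrow> (real^'n \<Rightarrow> real^'m) \<Rightarrow> (real^'n \<Rightarrow> real^'m) \<Rightarrow>
   (real^'n \<Rightarrow> real^'n) \<Rightarrow> (real^'n \<Rightarrow> real^'n) \<Rightarrow> real^'n::finite \<Rightarrow> real^'n" where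
  "deriv_weingarten G x V X Y u =
     levi_civita (induced_metric G x) X (weingarten G x V Y) u
     - weingarten G x V (levi_civita (induced_metric G x) X Y) u"

definition curly_W ::
  "(real^'m::finite \<Rightarrow> real^'m^'m) \<Rightarrow> (real^'n \<Rightarrow> real^'m) \<Rightarrow> ('p::finite \<Rightarrow> real^'n \<Rightarrow> real^'m) \<Rightarrow> 'p \<Rightarrow>
   (real^'n \<Rightarrow> real^'n) \<Rightarrow> (real^'n \<Rightarrow> real^'n) \<Rightarrow> real^'n::finite \<Rightarrow> real^'n" where
  "curly_W G x N A X Y u =
     deriv_weingarten G x (N A) X Y u - deriv_weingarten G x (N A) Y X u
     + (\<Sum>B\<in>UNIV.
          metric_inner (G (x u)) (normal_connection G x X (N B) u) (N A u) *\<^sub>R weingarten G x (N B) Y u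
        - metric_inner (G (x u)) (normal_connection G x Y (N B) u) (N A u) *\<^sub>R weingarten G x (N B) X u)"


section \<open>Nambu brackets\<close>

text \<open>The index type of the coordinates of the submanifold is linearly ordered, i.e. its
  coordinates are numbered.  If the list \<open>as\<close> of length \<open>CARD('n)\<close> has no repetition, it is
  the permutation that sends the \<open>k\<close>-th smallest index to \<open>as ! k\<close>.
  A density enters only through its component function \<open>\<rho>\<close> in the given coordinates.\<close>

definition eps :: "'n::{finite,linorder} list \<Rightarrow> real" where
  "eps as = (if distinct as then of_int (sign (\<lambda>c. as ! card {d. d < c})) else 0)"

definition nambu ::
  "(real^'n::{finite,linorder} \<Rightarrow> real) \<Rightarrow> (real^'n::{finite,linorder} \<Rightarrow> real) list \<Rightarrow>
   real^'n::{finite,linorder} \<Rightarrow> real" where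
  "nambu \<rho> fs u = (1 / \<rho> u) * (\<Sum>as | length as = CARD('n).
      eps as * (\<Prod>k<CARD('n). partial (as ! k) (fs ! k) u))"

text \<open>For \<open>CARD('n) = 2\<close> the inner sum below has the single summand \<open>as = []\<close>.\<close>

definition curly_C ::
  "(real^'m::finite \<Rightarrow> real^'m^'m) \<Rightarrow> (real^'n::{finite,linorder} \<Rightarrow> real^'m) \<Rightarrow>
   ('p::finite \<Rightarrow> real^'n::{finite,linorder} \<Rightarrow> real^'m) \<Rightarrow>
   (real^'n::{finite,linorder} \<Rightarrow> real) \<Rightarrow> 'p \<Rightarrow> (real^'n::{finite,linorder} \<Rightarrow> real) list \<Rightarrow>
   real^'n::{finite,linorder} \<Rightarrow> real^'n::{finite,linorder}" where
  "curly_C G x N \<rho> A fs u = (1 / (2 * \<rho> u)) *\<^sub>R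
     (\<Sum>a\<in>UNIV. \<Sum>b\<in>UNIV. \<Sum>as | length as = CARD('n) - 2.
        (eps (a # b # as) * (\<Prod>k<CARD('n) - 2. partial (as ! k) (fs ! k) u)) *\<^sub>R
        curly_W G x N A (\<lambda>_. axis a 1) (\<lambda>_. axis b 1) u)"

definition gamma_ratio ::
  "(real^'m \<Rightarrow> real^'m^'m) \<Rightarrow> (real^'n::finite \<Rightarrow> real^'m) \<Rightarrow> (real^'n::finite \<Rightarrow> real) \<Rightarrow>
   real^'n::finite \<Rightarrow> real" where
  "gamma_ratio G x \<rho> u = sqrt (det (induced_metric G x u)) / \<rho> u"

text \<open>Multi-indices are lists of length \<open>CARD('n) - 1\<close>.\<close>

definition P_tensor ::
  "(real^'n::{finite,linorder} \<Rightarrow> real^'m) \<Rightarrow> (real^'n::{finite,linorder} \<Rightarrow> real) \<Rightarrow> 'm \<Rightarrow>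
   'm list \<Rightarrow> real^'n::{finite,linorder} \<Rightarrow> real" where
  "P_tensor x \<rho> i J u = (1 / sqrt (fact (CARD('n) - 1))) *
     nambu \<rho> (map (\<lambda>j v. x v $ j) (i # J)) u"

definition P2_up ::
  "(real^'m \<Rightarrow> real^'m^'m) \<Rightarrow> (real^'n::{finite,linorder} \<Rightarrow> real^'m) \<Rightarrow>
   (real^'n::{finite,linorder} \<Rightarrow> real) \<Rightarrow> 'm \<Rightarrow> 'm \<Rightarrow>
   real^'n::{finite,linorder} \<Rightarrow> real" where
  "P2_up G x \<rho> i k u =
     (\<Sum>I | length I = CARD('n) - 1. \<Sum>J | length J = CARD('n) - 1.
        P_tensor x \<rho> i I u * P_tensor x \<rho> k J u *
        (\<Prod>l<CARD('n) - 1. G (x u) $ (I ! l) $ (J ! l)))"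

definition P2_mixed ::
  "(real^'m::finite \<Rightarrow> real^'m^'m) \<Rightarrow> (real^'n::{finite,linorder} \<Rightarrow> real^'m) \<Rightarrow>
   (real^'n::{finite,linorder} \<Rightarrow> real) \<Rightarrow> 'm \<Rightarrow> 'm \<Rightarrow>
   real^'n::{finite,linorder} \<Rightarrow> real" where
  "P2_mixed G x \<rho> i j u = (\<Sum>k\<in>UNIV. P2_up G x \<rho> i k u * G (x u) $ k $ j)"

end

theory Submission
  imports Defs
begin

text \<open>The Codazzi equation says that \<open>\<W>\<^sub>A(e\<^sub>a, e\<^sub>b)\<close> is minus the tangential part of the ambient
  curvature \<open>R(e\<^sub>a, e\<^sub>b) N\<^sub>A\<close>.  Written with the Christoffel symbols pulled back to the submanifold, the
  components of this curvature, contracted with \<open>\<epsilon>\<close>, are exactly the brackets on the right-hand side.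
  On the other hand \<open>\<P>\<^sup>2\<close> is \<open>\<gamma>\<^sup>2\<close> times the orthogonal projection onto the tangent space, because
  contracting two \<open>\<epsilon>\<close> symbols with \<open>n - 1\<close> copies of the Gram matrix gives \<open>(n - 1)!\<close> times its adjugate.\<close>

section \<open>The Levi-Civita symbol\<close>

text \<open>The curvature is that of a connection form along the submanifold, so it contains only
  \<open>u\<close>-derivatives of the pulled-back Christoffel symbols, the only ones a bracket can
  see; the ambient Riemann tensor is never formed. The obstacle is that second derivatives of the
  embedding enter the derivative of this form. They are symmetric in a and b, and the skew
  contraction with \<epsilon> removes them. Skewness also explains the constants. The two halves of
  the curvature contribute equally, and this 2 cancels the 1/2 in \<open>curly_C\<close>. The minus
  sign of the Codazzi equation cancels against the one that arises when \<open>x $ k\<close> is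
  moved into the first slot of the bracket. The factor (n - 1)! from the adjugate cancels against
  the two square roots in \<open>P_tensor\<close>. Since \<epsilon> is encoded by lists and ranks of
  indices, its properties are read off from determinants with rearranged rows.\<close>

lemma bij_betw_rank:
  "bij_betw (\<lambda>c::'n::{finite,linorder}. card {d. d < c}) UNIV {..<CARD('n)}"
proof -
  let ?r = "\<lambda>c::'n. card {d. d < c}"
  have mono: "?r c < ?r c'" if "c < c'" for c c'
    by (rule psubset_card_mono) (use that in \<open>auto dest: less_trans\<close>)
  have inj: "inj ?r"
    by (rule linorder_injI) (metis mono less_irrefl)
  have "?r c < CARD('n)" for c
    by (rule psubset_card_mono) auto
  then have "range ?r \<subseteq> {..<CARD('n)}"
    by auto
  moreover have "card (range ?r) = card {..<CARD('n)}"
    using inj by (simp add: card_image)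
  ultimately have "range ?r = {..<CARD('n)}"
    by (simp add: card_subset_eq)
  then show ?thesis
    using inj by (simp add: bij_betw_def)
qed

lemma rank_less_CARD: "card {d. d < (c::'n::{finite,linorder})} < CARD('n)"
  using bij_betwE[OF bij_betw_rank] by auto

lemma ex_rank:
  assumes "k < CARD('n::{finite,linorder})"
  obtains c :: "'n::{finite,linorder}" where "card {d. d < c} = k"
proof -
  have "k \<in> range (\<lambda>c::'n. card {d. d < c})"
    using assms bij_betw_imp_surj_on[OF bij_betw_rank[where 'n = 'n]] by simp
  then show ?thesis using that by blast
qed

lemma inj_rank: "card {d. d < (c::'n::{finite,linorder})} = card {d. d < c'} \<longleftrightarrow> c = c'"
  using injD[OF bij_betw_imp_inj_on[OF bij_betw_rank]] by auto

lemma bij_nth_rank: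
  fixes cs :: "'n::{finite,linorder} list"
  assumes "length cs = CARD('n)" "distinct cs"
  shows "bij (\<lambda>c::'n. cs ! card {d. d < c})"
proof -
  have "inj (\<lambda>c::'n. cs ! card {d. d < c})"
    using assms by (intro injI) (simp add: nth_eq_iff_index_eq rank_less_CARD inj_rank)
  then show ?thesis
    by (simp add: bij_def finite_UNIV_inj_surj)
qed

text \<open>Rearranging the rows by a permutation multiplies the determinant by its sign; a
  repetition in \<open>cs\<close> produces two equal rows, so both sides vanish. With
  \<open>g = mat 1\<close> this represents \<open>eps\<close> itself as a determinant.\<close>

lemma eps_mult_det:
  fixes g :: "real^'n::{finite,linorder}^'n::{finite,linorder}"
  assumes len: "length cs = CARD('n)"
  shows "eps cs * det g = det (\<chi> c. g $ (cs ! card {d. d < c}))"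
proof (cases "distinct cs")
  case True
  then have "(\<lambda>c. cs ! card {d. d < c}) permutes (UNIV::'n set)"
    using bij_nth_rank[OF len] by (intro bij_imp_permutes) auto
  from det_permute_rows[OF this, of g] show ?thesis
    using True by (simp add: eps_def)
next
  case False
  then obtain i j where ij: "i < CARD('n)" "j < CARD('n)" "i \<noteq> j" "cs ! i = cs ! j"
    using len by (auto simp: distinct_conv_nth)
  obtain c c' :: 'n where "card {d. d < c} = i" "card {d. d < c'} = j"
    using ij ex_rank by metis
  then have "det (\<chi> c. g $ (cs ! card {d. d < c})) = 0"
    using ij by (intro det_identical_rows[of c c']) (auto simp: row_def vec_eq_iff)
  then show ?thesis
    using False by (simp add: eps_def)
qed

lemma finite_lists_UNIV: "finite {as::'a::finite list. length as = k}"
  using finite_lists_length_eq[of "UNIV::'a set" k] by simp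

text \<open>This is the Leibniz formula in list form: lists with a repetition contribute 0, and the
  others correspond to permutations by composing with the rank map and its inverse.\<close>

lemma sum_eps_prod:
  fixes h :: "nat \<Rightarrow> 'n::{finite,linorder} \<Rightarrow> real"
  shows "(\<Sum>bs | length bs = CARD('n). eps bs * (\<Prod>k<CARD('n). h k (bs ! k)))
    = det (\<chi> c d. h (card {d. d < c}) d)"
proof -
  let ?r = "\<lambda>c::'n. card {d. d < c}"
  let ?D = "{bs::'n list. length bs = CARD('n) \<and> distinct bs}"
  let ?ri = "inv_into UNIV ?r"
  have ri: "?r (?ri k) = k" if "k < CARD('n)" for k
    using that bij_betw_inv_into_right[OF bij_betw_rank] by auto
  have rr: "?ri (?r c) = c" for c
    using bij_betw_inv_into_left[OF bij_betw_rank] by auto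
  have "(\<Sum>bs | length bs = CARD('n). eps bs * (\<Prod>k<CARD('n). h k (bs ! k)))
      = (\<Sum>bs\<in>?D. eps bs * (\<Prod>k<CARD('n). h k (bs ! k)))"
    by (intro sum.mono_neutral_right) (auto simp: finite_lists_UNIV eps_def)
  also have "\<dots> = (\<Sum>p | p permutes UNIV. of_int (sign p) * (\<Prod>c\<in>UNIV. h (?r c) (p c)))"
  proof (rule sum.reindex_bij_witness[where j = "\<lambda>bs c. bs ! ?r c"
        and i = "\<lambda>p. map (\<lambda>k. p (?ri k)) [0..<CARD('n)]"])
    fix bs assume bs: "bs \<in> ?D"
    show "map (\<lambda>k. bs ! ?r (?ri k)) [0..<CARD('n)] = bs"
      using bs by (auto intro!: nth_equalityI simp: ri)
    show "(\<lambda>c. bs ! ?r c) \<in> {p. p permutes UNIV}"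
      using bs bij_nth_rank[of bs] by (auto intro: bij_imp_permutes)
    show "of_int (sign (\<lambda>c. bs ! ?r c)) * (\<Prod>c\<in>UNIV. h (?r c) (bs ! ?r c))
        = eps bs * (\<Prod>k<CARD('n). h k (bs ! k))"
      using bs prod.reindex_bij_betw[OF bij_betw_rank, of "\<lambda>k. h k (bs ! k)"]
      by (simp add: eps_def)
  next
    fix p :: "'n \<Rightarrow> 'n" assume p: "p \<in> {p. p permutes UNIV}"
    show "(\<lambda>c. map (\<lambda>k. p (?ri k)) [0..<CARD('n)] ! ?r c) = p"
      by (auto simp: rank_less_CARD rr)
    have "inj_on (\<lambda>k. p (?ri k)) {0..<CARD('n)}"
      by (rule inj_onI) (metis p mem_Collect_eq permutes_inj injD ri atLeastLessThan_iff)
    then show "map (\<lambda>k. p (?ri k)) [0..<CARD('n)] \<in> ?D"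
      by (auto simp: distinct_map)
  qed
  finally show ?thesis
    by (simp add: det_def)
qed

lemma sum_eps_prod_matrix:
  fixes g :: "real^'n::{finite,linorder}^'n::{finite,linorder}"
  assumes "length cs = CARD('n)"
  shows "(\<Sum>bs | length bs = CARD('n). eps bs * (\<Prod>k<CARD('n). g $ (cs ! k) $ (bs ! k)))
    = eps cs * det g"
  by (simp add: sum_eps_prod[where h = "\<lambda>k d. g $ (cs ! k) $ d"] eps_mult_det[OF assms])

text \<open>Both values are determinants of rearranged identity matrices that differ by exchanging
  two rows, namely those at the indices of rank 0 and 1. These exist because the dimension is at
  least 2.\<close>

lemma eps_swap:
  fixes a b :: "'n::{finite,linorder}"
  assumes len: "length as = CARD('n) - 2" and n: "CARD('n) \<ge> 2"
  shows "eps (b # a # as) = - eps (a # b # as)"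
proof -
  obtain c0 c1 :: 'n where c: "card {d. d < c0} = 0" "card {d. d < c1} = 1"
    using ex_rank[of 0] ex_rank[of 1] n by (metis less_le_trans one_less_numeral_iff pos2 semiring_norm(76))
  then have ne: "c0 \<noteq> c1" by auto
  let ?M = "(\<chi> c. mat 1 $ ((a # b # as) ! card {d. d < c})) :: real^'n::{finite,linorder}^'n::{finite,linorder}"
  have p: "Transposition.transpose c0 c1 permutes (UNIV::'n set)"
    by (simp add: permutes_swap_id)
  have r: "card {d. d < c} \<noteq> 0" "card {d. d < c} \<noteq> 1" if "c \<noteq> c0" "c \<noteq> c1" for c
    using that c inj_rank by metis+
  have "(b # a # as) ! card {d. d < c} = (a # b # as) ! card {d. d < Transposition.transpose c0 c1 c}" for c
  proof (cases "c = c0 \<or> c = c1")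
    case True
    then show ?thesis using c by auto
  next
    case False
    then obtain k where "card {d. d < c} = Suc (Suc k)"
      using r by (metis One_nat_def not0_implies_Suc)
    then show ?thesis using False by simp
  qed
  then have "(\<chi> c. mat 1 $ ((b # a # as) ! card {d. d < c})) = (\<chi> c. ?M $ Transposition.transpose c0 c1 c)"
    by (simp only: vec_eq_iff vec_lambda_beta) simp
  moreover have "eps (b # a # as) * det (mat 1 :: real^'n::{finite,linorder}^'n::{finite,linorder})
      = det (\<chi> c. mat 1 $ ((b # a # as) ! card {d. d < c}))"
    using len n by (intro eps_mult_det) simp
  moreover have "det (\<chi> c. ?M $ Transposition.transpose c0 c1 c) = - det ?M"
    using ne by (subst det_permute_rows[OF p]) (simp add: sign_swap_id)
  moreover have "eps (a # b # as) * det (mat 1 :: real^'n::{finite,linorder}^'n::{finite,linorder}) = det ?M"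
    using len n by (intro eps_mult_det) simp
  ultimately show ?thesis
    by simp
qed

lemma sum_lists_Suc:
  fixes F :: "'a::finite list \<Rightarrow> 'b::comm_monoid_add"
  shows "(\<Sum>as | length as = Suc k. F as) = (\<Sum>a\<in>UNIV. \<Sum>as | length as = k. F (a # as))"
proof -
  have "(\<Sum>as | length as = Suc k. F as)
      = (\<Sum>(a, as)\<in>UNIV \<times> {as. length as = k}. F (a # as))"
    by (rule sum.reindex_bij_witness[where j = "\<lambda>as. (hd as, tl as)" and i = "\<lambda>(a, as). a # as"])
      (auto simp: length_Suc_conv)
  then show ?thesis
    by (simp add: sum.cartesian_product)
qed

text \<open>The distributive law, by induction on the length. It turns a sum over multi-indices into
  a product of sums over single indices, which is how Gram matrix entries arise.\<close>

lemma sum_lists_prod: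
  fixes h :: "nat \<Rightarrow> 'a::finite \<Rightarrow> 'b::comm_semiring_1"
  shows "(\<Sum>as | length as = k. \<Prod>l<k. h l (as ! l)) = (\<Prod>l<k. \<Sum>a\<in>UNIV. h l a)"
proof (induction k arbitrary: h)
  case (Suc k)
  have "(\<Sum>as | length as = Suc k. \<Prod>l<Suc k. h l (as ! l))
      = (\<Sum>a\<in>UNIV. h 0 a * (\<Sum>as | length as = k. \<Prod>l<k. h (Suc l) (as ! l)))"
    by (simp add: sum_lists_Suc prod.lessThan_Suc_shift sum_distrib_left del: prod.lessThan_Suc)
  also have "\<dots> = (\<Sum>a\<in>UNIV. h 0 a) * (\<Prod>l<k. \<Sum>a\<in>UNIV. h (Suc l) a)"
    by (simp add: Suc.IH[of "\<lambda>l. h (Suc l)"] sum_distrib_right)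
  finally show ?case
    by (simp add: prod.lessThan_Suc_shift del: prod.lessThan_Suc)
qed simp

text \<open>On the diagonal each admissible list contributes 1, and there are (n - 1)!
  repetition-free lists avoiding \<open>a\<close>. Off the diagonal, a repetition-free
  \<open>a # as\<close> exhausts all indices, so \<open>c\<close> already occurs in
  \<open>as\<close> and the second factor vanishes.\<close>

lemma sum_eps_eps:
  fixes a c :: "'n::{finite,linorder}"
  shows "(\<Sum>as | length as = CARD('n) - 1. eps (a # as) * eps (c # as))
    = (if a = c then fact (CARD('n) - 1) else 0)"
proof -
  have e2: "eps bs * eps bs = (if distinct bs then 1 else 0)" for bs :: "'n list"
    by (auto simp: eps_def sign_def)
  show ?thesis
  proof (cases "a = c")
    case True
    have "(\<Sum>as | length as = CARD('n) - 1. eps (a # as) * eps (a # as))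
        = real (card {as. length as = CARD('n) - 1 \<and> distinct (a # as)})"
      by (simp add: e2 finite_lists_UNIV sum.If_cases Int_def)
    also have "{as. length as = CARD('n) - 1 \<and> distinct (a # as)}
        = {as. length as = CARD('n) - 1 \<and> distinct as \<and> set as \<subseteq> UNIV - {a}}"
      by auto
    also have "card \<dots> = \<Prod>{1..CARD('n) - 1}"
      by (subst card_lists_distinct_length_eq) auto
    finally show ?thesis
      using True by (simp add: fact_prod)
  next
    case False
    have "eps (a # as) * eps (c # as) = 0" if "length as = CARD('n) - 1" for as
    proof (cases "distinct (a # as)")
      case True
      then have "card (set (a # as)) = CARD('n)"
        using that by (simp add: distinct_card)
      then have "c \<in> set (a # as)"
        by (metis UNIV_I card_eq_UNIV_imp_eq_UNIV finite)
      then show ?thesis using \<open>a \<noteq> c\<close> by (auto simp: eps_def)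
    qed (auto simp: eps_def)
    then have "(\<Sum>as | length as = CARD('n) - 1. eps (a # as) * eps (c # as)) = 0"
      by (intro sum.neutral) blast
    then show ?thesis using False by simp
  qed
qed

text \<open>The double sum is (n - 1)! times the cofactor at (a, b), so this is Laplace expansion
  along row \<open>a\<close> with row \<open>c\<close> substituted. The proof absorbs
  \<open>g $ c $ b\<close> as the first factor of a full product over \<open>c # as\<close>; the sum
  over \<open>b # bs\<close> then gives \<open>eps (c # as) * det g\<close>, and
  \<open>sum_eps_eps\<close> finishes.\<close>

lemma cofactor_identity:
  fixes g :: "real^'n::{finite,linorder}^'n::{finite,linorder}"
  shows "(\<Sum>b\<in>UNIV. (\<Sum>as | length as = CARD('n) - 1. \<Sum>bs | length bs = CARD('n) - 1.
      eps (a # as) * eps (b # bs) * (\<Prod>l<CARD('n) - 1. g $ (as ! l) $ (bs ! l))) * g $ c $ b)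
    = (if a = c then fact (CARD('n) - 1) * det g else 0)"
proof -
  let ?L = "{as::'n list. length as = CARD('n) - 1}"
  have n: "CARD('n) = Suc (CARD('n) - 1)"
    using card_gt_0_iff[of "UNIV::'n set"] by simp
  have "(\<Sum>b\<in>UNIV. (\<Sum>as\<in>?L. \<Sum>bs\<in>?L.
      eps (a # as) * eps (b # bs) * (\<Prod>l<CARD('n) - 1. g $ (as ! l) $ (bs ! l))) * g $ c $ b)
    = (\<Sum>b\<in>UNIV. \<Sum>as\<in>?L. eps (a # as) * (\<Sum>bs\<in>?L.
      eps (b # bs) * (g $ c $ b * (\<Prod>l<CARD('n) - 1. g $ (as ! l) $ (bs ! l)))))"
    by (simp add: sum_distrib_left sum_distrib_right mult_ac)
  also have "\<dots> = (\<Sum>as\<in>?L. eps (a # as) * (\<Sum>b\<in>UNIV. \<Sum>bs\<in>?L.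
      eps (b # bs) * (g $ c $ b * (\<Prod>l<CARD('n) - 1. g $ (as ! l) $ (bs ! l)))))"
    by (subst sum.swap) (simp add: sum_distrib_left)
  also have "\<dots> = (\<Sum>as\<in>?L. eps (a # as) * (eps (c # as) * det g))"
  proof (rule sum.cong, simp)
    fix as assume "as \<in> ?L"
    then have len: "length (c # as) = CARD('n)"
      using n by simp
    have "eps (c # as) * det g = (\<Sum>bs | length bs = Suc (CARD('n) - 1).
        eps bs * (\<Prod>k<Suc (CARD('n) - 1). g $ ((c # as) ! k) $ (bs ! k)))"
      using sum_eps_prod_matrix[OF len, of g] n by simp
    also have "\<dots> = (\<Sum>b\<in>UNIV. \<Sum>bs\<in>?L.
      eps (b # bs) * (g $ c $ b * (\<Prod>l<CARD('n) - 1. g $ (as ! l) $ (bs ! l))))"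
      by (simp only: sum_lists_Suc prod.lessThan_Suc_shift nth_Cons_0 nth_Cons_Suc o_def)
    finally show "eps (a # as) * (\<Sum>b\<in>UNIV. \<Sum>bs\<in>?L.
      eps (b # bs) * (g $ c $ b * (\<Prod>l<CARD('n) - 1. g $ (as ! l) $ (bs ! l))))
      = eps (a # as) * (eps (c # as) * det g)" by simp
  qed
  also have "\<dots> = (\<Sum>as\<in>?L. eps (a # as) * eps (c # as)) * det g"
    by (simp only: sum_distrib_right mult.assoc)
  also have "\<dots> = (if a = c then fact (CARD('n) - 1) * det g else 0)"
    by (simp only: sum_eps_eps) simp
  finally show ?thesis .
qed

section \<open>Partial derivatives\<close>

lemma partial_eqI: "(f has_derivative f') (at u) \<Longrightarrow> partial a f u = f' (axis a 1)"
  by (simp add: partial_def frechet_derivative_at[symmetric])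

text \<open>Functions that agree near \<open>u\<close> have the same derivatives there, so the
  choice inside \<open>frechet_derivative\<close> returns the same map. This is why no
  differentiability is assumed.\<close>

lemma partial_cong:
  assumes "open U" "u \<in> U" "\<And>v. v \<in> U \<Longrightarrow> f v = g v"
  shows "partial a f u = partial a g u"
proof -
  have "(f has_derivative f') (at u) \<longleftrightarrow> (g has_derivative f') (at u)" for f'
    using assms by (metis has_derivative_transform_within_open)
  then show ?thesis
    by (simp add: partial_def frechet_derivative_def)
qed

lemma differentiable_cong_open:
  assumes "f differentiable (at u)" "open U" "u \<in> U" "\<And>v. v \<in> U \<Longrightarrow> f v = g v"
  shows "g differentiable (at u)"
  using assms unfolding differentiable_def by (metis has_derivative_transform_within_open)

lemma partial_const: "partial a (\<lambda>v. k) u = 0"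
  by (rule partial_eqI) simp

lemma partial_add:
  assumes "f differentiable (at u)" "g differentiable (at u)"
  shows "partial a (\<lambda>v. f v + g v) u = partial a f u + partial a g u"
  using assms by (auto simp: partial_def frechet_derivative_works intro!: partial_eqI[unfolded partial_def] has_derivative_add)

lemma partial_uminus:
  assumes "f differentiable (at u)"
  shows "partial a (\<lambda>v. - f v) u = - partial a f u"
  using assms by (auto simp: partial_def frechet_derivative_works intro!: partial_eqI[unfolded partial_def] has_derivative_minus)

lemma partial_sum:
  assumes "\<And>i. i \<in> I \<Longrightarrow> f i differentiable (at u)"
  shows "partial a (\<lambda>v. \<Sum>i\<in>I. f i v) u = (\<Sum>i\<in>I. partial a (f i) u)"
  using assms by (auto simp: partial_def frechet_derivative_works intro!: partial_eqI[unfolded partial_def] has_derivative_sum)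

text \<open>Proved once for bounded bilinear maps, since products of scalars, scalar multiples,
  inner products and matrix-vector products all have to be differentiated.\<close>

lemma (in bounded_bilinear) partial_prod:
  assumes "f differentiable (at u)" "g differentiable (at u)"
  shows "partial a (\<lambda>v. prod (f v) (g v)) u = prod (partial a f u) (g u) + prod (f u) (partial a g u)"
proof -
  have "((\<lambda>v. prod (f v) (g v)) has_derivative
      (\<lambda>h. prod (f u) (frechet_derivative g (at u) h) + prod (frechet_derivative f (at u) h) (g u))) (at u)"
    using assms by (intro FDERIV) (auto simp: frechet_derivative_works)
  from partial_eqI[OF this] show ?thesis
    by (simp add: partial_def add.commute)
qed

lemma (in bounded_bilinear) differentiable_prod:
  assumes "f differentiable (at u)" "g differentiable (at u)"
  shows "(\<lambda>v. prod (f v) (g v)) differentiable (at u)"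
  using assms FDERIV unfolding differentiable_def by blast

lemmas partial_mult = bounded_bilinear.partial_prod[OF bounded_bilinear_mult]
  and partial_scaleR = bounded_bilinear.partial_prod[OF bounded_bilinear_scaleR]
  and partial_inner = bounded_bilinear.partial_prod[OF bounded_bilinear_inner]

lemma bounded_bilinear_matrix_vector_mult:
  "bounded_bilinear ((*v) :: real^'n^'m \<Rightarrow> real^'n \<Rightarrow> real^'m)"
  unfolding bilinear_conv_bounded_bilinear[symmetric] bilinear_def
  by (auto simp: linear_iff vec_eq_iff matrix_vector_mult_def algebra_simps sum.distrib sum_distrib_left)

lemmas partial_matrix_vector_mult = bounded_bilinear.partial_prod[OF bounded_bilinear_matrix_vector_mult]
  and differentiable_matrix_vector_mult = bounded_bilinear.differentiable_prod[OF bounded_bilinear_matrix_vector_mult]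

lemma differentiable_component:
  fixes f :: "'a::real_normed_vector \<Rightarrow> 'b::real_normed_vector^'n"
  assumes "f differentiable (at u)"
  shows "(\<lambda>v. f v $ i) differentiable (at u)"
  using assms bounded_linear.has_derivative[OF bounded_linear_vec_nth] unfolding differentiable_def by blast

lemma partial_component:
  fixes f :: "real^'d \<Rightarrow> 'b::real_normed_vector^'n"
  assumes "f differentiable (at u)"
  shows "partial a (\<lambda>v. f v $ i) u = partial a f u $ i"
  using assms bounded_linear.has_derivative[OF bounded_linear_vec_nth, of f _ _ i]
  by (auto simp: partial_def frechet_derivative_works intro!: partial_eqI[unfolded partial_def])

lemma bounded_linear_axis: "bounded_linear (axis i :: 'b::real_normed_vector \<Rightarrow> 'b^'n)"
proof (rule bounded_linear_intro[where K = 1])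
  fix y :: 'b
  have "norm (axis i y :: 'b^'n) \<le> (\<Sum>j\<in>UNIV. norm (axis i y $ j :: 'b))"
    unfolding norm_vec_def by (rule L2_set_le_sum) simp
  also have "\<dots> = norm y"
    by (simp add: axis_def if_distrib cong: if_cong)
  finally show "norm (axis i y :: 'b^'n) \<le> norm y * 1" by simp
qed (auto simp: axis_def vec_eq_iff)

lemma differentiable_vecI:
  fixes f :: "'a::real_normed_vector \<Rightarrow> 'b::real_normed_vector^'n"
  assumes "\<And>i. (\<lambda>v. f v $ i) differentiable (at u)"
  shows "f differentiable (at u)"
proof -
  have "(\<lambda>v. axis i (f v $ i)) differentiable (at u)" for i :: 'n
    using assms[of i] bounded_linear.has_derivative[OF bounded_linear_axis] unfolding differentiable_def by blast
  then have "(\<lambda>v. \<Sum>i\<in>(UNIV::'n set). axis i (f v $ i)) differentiable (at u)"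
    by (intro differentiable_sum) auto
  moreover have "(\<lambda>v. \<Sum>i\<in>UNIV. axis i (f v $ i)) = f"
    by (auto simp: fun_eq_iff vec_eq_iff axis_def if_distrib cong: if_cong)
  ultimately show ?thesis
    by simp
qed

section \<open>Differentiability of determinants and inverse matrices\<close>

lemma differentiable_prod_set:
  fixes f :: "'i \<Rightarrow> 'a::real_normed_vector \<Rightarrow> real"
  assumes "finite I" "\<And>i. i \<in> I \<Longrightarrow> f i differentiable (at u)"
  shows "(\<lambda>v. \<Prod>i\<in>I. f i v) differentiable (at u)"
  using assms by (induction I rule: finite_induct) auto

lemma differentiable_det:
  fixes M :: "'a::real_normed_vector \<Rightarrow> real^'n^'n"
  assumes "\<And>i j. (\<lambda>v. M v $ i $ j) differentiable (at u)"
  shows "(\<lambda>v. det (M v)) differentiable (at u)"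
  unfolding det_def by (intro differentiable_sum differentiable_mult differentiable_prod_set ballI)
    (auto simp: finite_permutations assms)

lemma matrix_inv_works:
  fixes M :: "real^'n^'n"
  assumes "det M \<noteq> 0"
  shows "M ** matrix_inv M = mat 1" "matrix_inv M ** M = mat 1"
proof -
  have "\<exists>M'. M ** M' = mat 1 \<and> M' ** M = mat 1"
    using assms by (simp flip: invertible_def add: invertible_det_nz)
  then have "M ** matrix_inv M = mat 1 \<and> matrix_inv M ** M = mat 1"
    unfolding matrix_inv_def by (rule someI_ex)
  then show "M ** matrix_inv M = mat 1" "matrix_inv M ** M = mat 1"
    by auto
qed

text \<open>Cramer's rule, applied to the equation for a column of the inverse. Each entry becomes a
  quotient of determinants, from which differentiability is immediate.\<close>

lemma matrix_inv_nth:
  fixes M :: "real^'n^'n"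
  assumes "det M \<noteq> 0"
  shows "matrix_inv M $ k $ l = det (\<chi> i j. if j = k then axis l 1 $ i else M $ i $ j) / det M"
proof -
  have "M *v (matrix_inv M *v axis l 1) = axis l 1"
    by (simp add: matrix_vector_mul_assoc matrix_inv_works(1)[OF assms])
  then have "matrix_inv M *v axis l 1 = (\<chi> k. det (\<chi> i j. if j = k then axis l 1 $ i else M $ i $ j) / det M)"
    by (simp add: cramer[OF assms])
  moreover have "matrix_inv M $ k $ l = (matrix_inv M *v axis l 1) $ k"
    by (simp add: matrix_vector_mult_basis column_def)
  ultimately show ?thesis by simp
qed

lemma differentiable_matrix_inv:
  fixes M :: "'a::real_normed_vector \<Rightarrow> real^'n^'n"
  assumes "M differentiable (at u)" "open U" "u \<in> U" "\<And>v. v \<in> U \<Longrightarrow> det (M v) \<noteq> 0"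
  shows "(\<lambda>v. matrix_inv (M v)) differentiable (at u)"
proof (intro differentiable_vecI)
  fix k l
  have M: "(\<lambda>v. M v $ i $ j) differentiable (at u)" for i j
    using assms(1) by (intro differentiable_component)
  have "(\<lambda>v. det (\<chi> i j. if j = k then axis l 1 $ i else M v $ i $ j) / det (M v)) differentiable (at u)"
  proof (intro differentiable_divide differentiable_det)
    show "(\<lambda>v. (\<chi> i j. if j = k then axis l 1 $ i else M v $ i $ j) $ i $ j) differentiable (at u)" for i j
      using M by (cases "j = k") auto
  qed (use assms M in auto)
  then show "(\<lambda>v. matrix_inv (M v) $ k $ l) differentiable (at u)"
    by (rule differentiable_cong_open[OF _ assms(2,3)]) (simp add: matrix_inv_nth assms(4))
qed

lemma partial_compose:
  fixes f :: "real^'m \<Rightarrow> 'b::real_normed_vector" and x :: "real^'n \<Rightarrow> real^'m"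
  assumes "x differentiable (at u)" "f differentiable (at (x u))"
  shows "partial a (\<lambda>v. f (x v)) u = (\<Sum>k\<in>UNIV. partial a x u $ k *\<^sub>R partial k f (x u))"
proof -
  have "partial a (\<lambda>v. f (x v)) u = frechet_derivative f (at (x u)) (partial a x u)"
    using assms diff_chain_at[of x _ u f]
    by (auto simp: partial_def frechet_derivative_works o_def intro!: partial_eqI[unfolded partial_def])
  also have "\<dots> = (\<Sum>k\<in>UNIV. partial a x u $ k *\<^sub>R partial k f (x u))"
    by (subst basis_expansion[symmetric, of "partial a x u"], unfold partial_def scalar_mult_eq_scaleR,
      subst linear_sum[OF linear_frechet_derivative[OF assms(2)]])
      (simp add: linear_cmul[OF linear_frechet_derivative[OF assms(2)]])
  finally show ?thesis .
qed

lemma differentiable_compose_at: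
  assumes "x differentiable (at u)" "f differentiable (at (x u))"
  shows "(\<lambda>v. f (x v)) differentiable (at u)"
  using differentiable_chain_at[OF assms] by (simp add: o_def)

section \<open>Twice differentiable functions and the symmetry of second derivatives\<close>

definition diff2_on :: "(real^'d::finite) set \<Rightarrow> (real^'d \<Rightarrow> 'b::real_normed_vector) \<Rightarrow> bool" where
  "diff2_on U f \<longleftrightarrow> (\<forall>u\<in>U. f differentiable (at u) \<and> (\<forall>a. partial a f differentiable (at u)))"

text \<open>The geometry below works at this regularity: it is what a differentiable Christoffel
  symbol asks of the metric, and what an iterated covariant derivative asks of a field.\<close>

lemma smooth_on_imp_diff2_on:
  assumes "smooth_on U f"
  shows "diff2_on U f"
proof -
  have "Ck_on (Suc (Suc 0)) U f"
    using assms smooth_on_def by blast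
  then show ?thesis
    by (auto simp: diff2_on_def partial_def[abs_def])
qed

lemma diff2_on_component:
  fixes f :: "real^'d \<Rightarrow> 'b::real_normed_vector^'n"
  assumes "diff2_on U f" "open U"
  shows "diff2_on U (\<lambda>v. f v $ i)"
  unfolding diff2_on_def
proof (intro ballI conjI allI)
  fix u a assume u: "u \<in> U"
  show "(\<lambda>v. f v $ i) differentiable (at u)"
    using assms u by (auto simp: diff2_on_def intro: differentiable_component)
  have "(\<lambda>v. partial a f v $ i) differentiable (at u)"
    using assms u by (auto simp: diff2_on_def intro: differentiable_component)
  then show "partial a (\<lambda>v. f v $ i) differentiable (at u)"
    by (rule differentiable_cong_open[OF _ assms(2) u])
      (use assms in \<open>simp add: partial_component diff2_on_def\<close>)
qed

text \<open>Young's form of the theorem: differentiability of the first derivatives at the point is enough,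
  because the second difference is \<open>t\<^sup>2\<close> times the iterated derivative up to \<open>o(t\<^sup>2)\<close>.\<close>

lemma second_difference:
  fixes f :: "'a::real_normed_vector \<Rightarrow> real"
  assumes U: "open U" "u \<in> U" and f: "\<And>y. y \<in> U \<Longrightarrow> f differentiable (at y)"
    and D: "((\<lambda>y. frechet_derivative f (at y) v) has_derivative D) (at u)" and e: "e > 0"
  obtains d where "d > 0" "\<And>t. 0 < t \<Longrightarrow> t < d \<Longrightarrow>
    \<bar>f (u + t *\<^sub>R v + t *\<^sub>R w) - f (u + t *\<^sub>R v) - f (u + t *\<^sub>R w) + f u - t\<^sup>2 * D w\<bar> \<le> e * t\<^sup>2"
proof -
  let ?F = "\<lambda>y. frechet_derivative f (at y) v"
  \<comment> \<open>Two linearisation errors, each at most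
    \<open>e / K * t * (norm v + norm w)\<close>, must add up to at most \<open>e * t\<close>. The
    summand 1 keeps \<open>K\<close> positive when both vectors vanish.\<close>
  define K where "K = 2 * (norm v + norm w) + 1"
  have K: "K > 0" by (simp add: K_def add_nonneg_pos)
  have lin: "linear D" using D has_derivative_linear by blast
  obtain r where r: "r > 0" "ball u r \<subseteq> U"
    using U openE by blast
  obtain s where s: "s > 0" "\<And>y. norm (y - u) < s \<Longrightarrow> norm (?F y - ?F u - D (y - u)) \<le> e / K * norm (y - u)"
    using D e K unfolding has_derivative_at_alt by (metis divide_pos_pos)
  define d where "d = min r s / K"
  show ?thesis
  proof (rule that[of d])
    show "d > 0" using r s K by (simp add: d_def)
    fix t :: real assume t: "0 < t" "t < d"
    have tK: "t * K < min r s"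
      using t K by (simp add: d_def pos_less_divide_eq)
    have small: "norm (q *\<^sub>R v + p *\<^sub>R w) \<le> t * (norm v + norm w)"
      if "0 \<le> q" "q \<le> t" "0 \<le> p" "p \<le> t" for q p
    proof -
      have "norm (q *\<^sub>R v + p *\<^sub>R w) \<le> norm (q *\<^sub>R v) + norm (p *\<^sub>R w)"
        by (rule norm_triangle_ineq)
      also have "\<dots> \<le> t * norm v + t * norm w"
        using that by (intro add_mono) (auto intro: mult_right_mono)
      finally show ?thesis by (simp add: algebra_simps)
    qed
    have lt: "t * (norm v + norm w) < min r s"
    proof -
      have "t * (norm v + norm w) \<le> t * K"
        using t by (intro mult_left_mono) (auto simp: K_def)
      then show ?thesis using tK by simp
    qed
    have inU: "u + q *\<^sub>R v + p *\<^sub>R w \<in> U" if "0 \<le> q" "q \<le> t" "0 \<le> p" "p \<le> t" for q p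
    proof -
      have "dist (u + q *\<^sub>R v + p *\<^sub>R w) u < r"
        using small[OF that] lt by (simp add: dist_norm add.assoc)
      then show ?thesis using r by (auto simp: dist_commute)
    qed
    let ?\<phi> = "\<lambda>q. f (u + q *\<^sub>R v + t *\<^sub>R w) - f (u + q *\<^sub>R v)"
    have der: "((\<lambda>q. f (u + q *\<^sub>R v + p *\<^sub>R w)) has_real_derivative ?F (u + q *\<^sub>R v + p *\<^sub>R w)) (at q)"
      if "0 \<le> q" "q \<le> t" "0 \<le> p" "p \<le> t" for q p
    proof -
      let ?y = "u + q *\<^sub>R v + p *\<^sub>R w"
      have fd: "f differentiable (at ?y)" using f inU[OF that] by blast
      have "((\<lambda>q. u + q *\<^sub>R v + p *\<^sub>R w) has_derivative (\<lambda>h. h *\<^sub>R v)) (at q)"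
        by (auto intro!: derivative_eq_intros)
      from diff_chain_at[OF this, of f "frechet_derivative f (at ?y)"] fd
      have "((\<lambda>q. f (u + q *\<^sub>R v + p *\<^sub>R w)) has_derivative (\<lambda>h. frechet_derivative f (at ?y) (h *\<^sub>R v))) (at q)"
        by (simp add: frechet_derivative_works o_def)
      moreover have "(\<lambda>h. frechet_derivative f (at ?y) (h *\<^sub>R v)) = (*) (?F ?y)"
        using linear_cmul[OF linear_frechet_derivative[OF fd]] by (simp add: fun_eq_iff mult.commute)
      ultimately show ?thesis by (simp add: has_field_derivative_def)
    qed
    \<comment> \<open>The mean value theorem is used in direction \<open>v\<close> only. What
      remains is a difference of first derivatives at two points near \<open>u\<close>, and
      differentiability at \<open>u\<close> controls both.\<close>
    have "\<exists>z>0. z < t \<and> ?\<phi> t - ?\<phi> 0 = (t - 0) * (?F (u + z *\<^sub>R v + t *\<^sub>R w) - ?F (u + z *\<^sub>R v))"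
      by (rule MVT2) (use t der[of _ t] der[of _ 0] in \<open>auto intro!: DERIV_diff\<close>)
    then obtain z where z: "0 < z" "z < t"
      and eq: "?\<phi> t - ?\<phi> 0 = t * (?F (u + z *\<^sub>R v + t *\<^sub>R w) - ?F (u + z *\<^sub>R v))"
      by auto
    let ?A = "?F (u + z *\<^sub>R v + t *\<^sub>R w) - ?F u - D (z *\<^sub>R v + t *\<^sub>R w)"
    let ?B = "?F (u + z *\<^sub>R v) - ?F u - D (z *\<^sub>R v)"
    have bd: "\<bar>?F (u + z *\<^sub>R v + p *\<^sub>R w) - ?F u - D (z *\<^sub>R v + p *\<^sub>R w)\<bar> \<le> e / K * (t * (norm v + norm w))"
      if "0 \<le> p" "p \<le> t" for p
    proof -
      let ?h = "z *\<^sub>R v + p *\<^sub>R w"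
      have h: "norm ?h \<le> t * (norm v + norm w)" using small z that by simp
      then have "norm ((u + ?h) - u) < s" using lt by simp
      from s(2)[OF this] have "\<bar>?F (u + z *\<^sub>R v + p *\<^sub>R w) - ?F u - D ?h\<bar> \<le> e / K * norm ?h"
        by (simp add: add.assoc)
      also have "\<dots> \<le> e / K * (t * (norm v + norm w))"
        using h e K by (intro mult_left_mono) auto
      finally show ?thesis .
    qed
    have "\<bar>?A - ?B\<bar> \<le> 2 * (e / K * (t * (norm v + norm w)))"
      using bd[of t] bd[of 0] t by simp
    also have "\<dots> = e / K * t * (2 * (norm v + norm w))" by simp
    also have "\<dots> \<le> e / K * t * K"
      using e K t by (intro mult_left_mono) (auto simp: K_def)
    also have "\<dots> = e * t" using K by simp
    finally have AB: "\<bar>?A - ?B\<bar> \<le> e * t" .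
    have "D (z *\<^sub>R v + t *\<^sub>R w) = D (z *\<^sub>R v) + t * D w"
      using lin by (simp add: linear_add linear_cmul)
    then have "f (u + t *\<^sub>R v + t *\<^sub>R w) - f (u + t *\<^sub>R v) - f (u + t *\<^sub>R w) + f u - t\<^sup>2 * D w = t * (?A - ?B)"
      using eq by (simp add: power2_eq_square algebra_simps)
    then have "\<bar>f (u + t *\<^sub>R v + t *\<^sub>R w) - f (u + t *\<^sub>R v) - f (u + t *\<^sub>R w) + f u - t\<^sup>2 * D w\<bar> = t * \<bar>?A - ?B\<bar>"
      using t by (simp add: abs_mult)
    also have "\<dots> \<le> t * (e * t)"
      using AB t by (intro mult_left_mono) auto
    finally show "\<bar>f (u + t *\<^sub>R v + t *\<^sub>R w) - f (u + t *\<^sub>R v) - f (u + t *\<^sub>R w) + f u - t\<^sup>2 * D w\<bar> \<le> e * t\<^sup>2"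
      by (simp add: power2_eq_square mult_ac)
  qed
qed

text \<open>The second difference is symmetric in \<open>v\<close> and \<open>w\<close>, and divided
  by the square of \<open>t\<close> it approximates both \<open>D w\<close> and
  \<open>E v\<close>.\<close>

lemma symmetric_second_derivative:
  fixes f :: "'a::real_normed_vector \<Rightarrow> real"
  assumes U: "open U" "u \<in> U" and f: "\<And>y. y \<in> U \<Longrightarrow> f differentiable (at y)"
    and D: "((\<lambda>y. frechet_derivative f (at y) v) has_derivative D) (at u)"
    and E: "((\<lambda>y. frechet_derivative f (at y) w) has_derivative E) (at u)"
  shows "D w = E v"
proof (rule ccontr)
  assume "D w \<noteq> E v"
  \<comment> \<open>With a third of the gap as tolerance, the two errors together cover only two
    thirds of it.\<close>
  define e where "e = \<bar>D w - E v\<bar> / 3"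
  have e: "e > 0" using \<open>D w \<noteq> E v\<close> by (simp add: e_def)
  obtain d1 where d1: "d1 > 0" "\<And>t. 0 < t \<Longrightarrow> t < d1 \<Longrightarrow>
    \<bar>f (u + t *\<^sub>R v + t *\<^sub>R w) - f (u + t *\<^sub>R v) - f (u + t *\<^sub>R w) + f u - t\<^sup>2 * D w\<bar> \<le> e * t\<^sup>2"
    using second_difference[OF U f D e] by blast
  obtain d2 where d2: "d2 > 0" "\<And>t. 0 < t \<Longrightarrow> t < d2 \<Longrightarrow>
    \<bar>f (u + t *\<^sub>R w + t *\<^sub>R v) - f (u + t *\<^sub>R w) - f (u + t *\<^sub>R v) + f u - t\<^sup>2 * E v\<bar> \<le> e * t\<^sup>2"
    using second_difference[OF U f E e] by blast
  define t where "t = min d1 d2 / 2"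
  have t: "0 < t" "t < d1" "t < d2" using d1 d2 by (auto simp: t_def)
  have "u + t *\<^sub>R w + t *\<^sub>R v = u + t *\<^sub>R v + t *\<^sub>R w" by simp
  note d2(2)[OF t(1,3), unfolded this]
  then have "\<bar>t\<^sup>2 * D w - t\<^sup>2 * E v\<bar> \<le> 2 * (e * t\<^sup>2)"
    using d1(2)[OF t(1,2)] by linarith
  then have "t\<^sup>2 * \<bar>D w - E v\<bar> \<le> 2 * (e * t\<^sup>2)"
    by (simp add: abs_mult flip: right_diff_distrib)
  then have "t\<^sup>2 * \<bar>D w - E v\<bar> \<le> t\<^sup>2 * (2 * e)"
    by (simp add: mult_ac)
  then have "\<bar>D w - E v\<bar> \<le> 2 * e" using t by simp
  then show False using e by (simp add: e_def)
qed

lemma partial_commute: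
  fixes f :: "real^'d \<Rightarrow> real"
  assumes "open U" "u \<in> U" "diff2_on U f"
  shows "partial a (partial b f) u = partial b (partial a f) u"
proof -
  have "((\<lambda>y. frechet_derivative f (at y) (axis a 1)) has_derivative
      frechet_derivative (partial a f) (at u)) (at u)" for a
    using assms unfolding diff2_on_def partial_def[abs_def] frechet_derivative_works by auto
  from symmetric_second_derivative[OF assms(1,2) _ this this] show ?thesis
    using assms(3) by (simp add: partial_def[of _ "partial _ f"] diff2_on_def)
qed

lemma partial_commute_vec:
  fixes f :: "real^'d \<Rightarrow> real^'n"
  assumes "open U" "u \<in> U" "diff2_on U f"
  shows "partial a (partial b f) u = partial b (partial a f) u"
proof -
  have "partial a (partial b f) u $ i = partial a (partial b (\<lambda>v. f v $ i)) u" for a b i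
  proof -
    have "partial a (partial b f) u $ i = partial a (\<lambda>v. partial b f v $ i) u"
      using assms by (simp add: partial_component diff2_on_def)
    also have "\<dots> = partial a (partial b (\<lambda>v. f v $ i)) u"
      by (rule partial_cong[OF assms(1,2)]) (use assms(3) in \<open>simp add: partial_component diff2_on_def\<close>)
    finally show ?thesis .
  qed
  then show ?thesis
    using partial_commute[OF assms(1,2) diff2_on_component[OF assms(3,1)]] by (simp add: vec_eq_iff)
qed

text \<open>Lowering the index cancels the inverse metric and leaves the symbol of the first kind.
  Both metric compatibility and the Gauss formula are proved from this form.\<close>

lemma christoffel_lower:
  fixes G :: "real^'d \<Rightarrow> real^'d^'d"
  assumes "det (G z) \<noteq> 0"
  shows "(\<Sum>i\<in>UNIV. G z $ p $ i * christoffel G i j k z) = 1/2 *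
    (partial j (\<lambda>y. G y $ p $ k) z + partial k (\<lambda>y. G y $ p $ j) z - partial p (\<lambda>y. G y $ j $ k) z)"
proof -
  let ?S = "\<lambda>l. partial j (\<lambda>y. G y $ l $ k) z + partial k (\<lambda>y. G y $ l $ j) z - partial l (\<lambda>y. G y $ j $ k) z"
  have "(\<Sum>i\<in>UNIV. G z $ p $ i * christoffel G i j k z)
      = 1/2 * (G z *v (matrix_inv (G z) *v (\<chi> l. ?S l))) $ p"
    by (simp add: christoffel_def matrix_vector_mult_def sum_distrib_left mult_ac)
  then show ?thesis
    by (simp add: matrix_vector_mul_assoc matrix_inv_works(1)[OF assms])
qed

lemma differentiable_christoffel:
  fixes G :: "real^'d \<Rightarrow> real^'d^'d"
  assumes "open V" "z \<in> V" "diff2_on V G" "\<And>y. y \<in> V \<Longrightarrow> det (G y) \<noteq> 0"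
  shows "christoffel G i j k differentiable (at z)"
proof -
  have p: "partial a (\<lambda>y. G y $ p $ q) differentiable (at z)" for a p q
    using diff2_on_component[OF diff2_on_component[OF assms(3,1)] assms(1)] assms(2)
    by (simp add: diff2_on_def)
  have "(\<lambda>y. matrix_inv (G y) $ i $ l) differentiable (at z)" for l
    by (intro differentiable_component differentiable_matrix_inv[OF _ assms(1,2)])
      (use assms in \<open>auto simp: diff2_on_def\<close>)
  with p show ?thesis
    unfolding christoffel_def[abs_def]
    by (intro differentiable_mult differentiable_sum differentiable_add differentiable_diff ballI) auto
qed

text \<open>On the segment from the identity to \<open>M\<close> every matrix is positive definite.
  If \<open>det M\<close> were not positive, the determinant would vanish somewhere on it, and a
  kernel vector would contradict positivity.\<close>

lemma det_pos_if_pos_def: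
  fixes M :: "real^'n^'n"
  assumes pos: "\<And>v. v \<noteq> 0 \<Longrightarrow> v \<bullet> (M *v v) > 0"
  shows "det M > 0"
proof (rule ccontr)
  assume neg: "\<not> det M > 0"
  let ?M = "\<lambda>t::real. (1 - t) *\<^sub>R mat 1 + t *\<^sub>R M"
  have "\<exists>t\<ge>0. t \<le> 1 \<and> det (?M t) = 0"
  proof (rule IVT2)
    show "\<forall>t. 0 \<le> t \<and> t \<le> 1 \<longrightarrow> isCont (\<lambda>t. det (?M t)) t"
      unfolding det_def by (intro allI impI continuous_intros)
  qed (use neg in auto)
  then obtain t where t: "0 \<le> t" "t \<le> 1" "det (?M t) = 0" by blast
  then have "\<not> (\<exists>B. B ** ?M t = mat 1)"
    by (metis invertible_def invertible_det_nz matrix_left_right_inverse)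
  then obtain v where v: "v \<noteq> 0" "?M t *v v = 0"
    using matrix_left_invertible_ker by blast
  have eq: "(1 - t) * (v \<bullet> v) + t * (v \<bullet> (M *v v)) = 0"
  proof -
    have "v \<bullet> (?M t *v v) = (1 - t) * (v \<bullet> v) + t * (v \<bullet> (M *v v))"
      by (simp add: matrix_vector_mult_add_rdistrib inner_add_right flip: scaleR_matrix_vector_assoc)
    then show ?thesis using v by simp
  qed
  have "v \<bullet> v > 0" "v \<bullet> (M *v v) > 0" using v pos by auto
  then show False using eq t
    by (smt (verit, best) mult_nonneg_nonneg mult_pos_pos)
qed

lemma metric_inner_eq: "metric_inner g v w = v \<bullet> (g *v w)"
  by (simp add: metric_inner_def inner_vec_def matrix_vector_mult_def sum_distrib_left mult_ac)

lemma bounded_bilinear_metric_inner: "bounded_bilinear (metric_inner (g::real^'d^'d))"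
  unfolding bilinear_conv_bounded_bilinear[symmetric] bilinear_def
  by (auto simp: linear_iff metric_inner_eq inner_add_left inner_add_right matrix_vector_right_distrib
      matrix_vector_mult_scaleR)

interpretation metric_inner: bounded_bilinear "metric_inner (g::real^'d^'d)" for g
  by (rule bounded_bilinear_metric_inner)

lemma inner_transpose_mult: "v \<bullet> (transpose M *v w) = (M *v v) \<bullet> (w::real^'n)"
  by (metis dot_lmul_matrix inner_commute transpose_matrix_vector transpose_transpose)

lemma metric_inner_commute:
  assumes "transpose g = g"
  shows "metric_inner g v w = metric_inner g w v"
  using inner_transpose_mult[of v g w] assms by (simp add: metric_inner_eq inner_commute)

lemma symmetric_matrix_nth:
  assumes "transpose M = M"
  shows "M $ i $ j = M $ j $ i"
  using arg_cong[OF assms, of "\<lambda>M. M $ j $ i"] by (simp add: transpose_def)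

lemma christoffel_commute:
  fixes G :: "real^'d \<Rightarrow> real^'d^'d"
  assumes "open V" "z \<in> V" "\<And>y. y \<in> V \<Longrightarrow> transpose (G y) = G y"
  shows "christoffel G i j k z = christoffel G i k j z"
proof -
  have "partial l (\<lambda>y. G y $ j $ k) z = partial l (\<lambda>y. G y $ k $ j) z" for l
    by (rule partial_cong[OF assms(1,2)]) (simp add: symmetric_matrix_nth assms(3))
  then show ?thesis
    by (simp add: christoffel_def add.commute)
qed

section \<open>Immersed submanifolds in coordinates\<close>

text \<open>The manifolds are replaced by one pair of coordinate systems. The hypotheses hold on
  open sets because the fields are differentiated; positivity makes both the ambient and the induced
  metric invertible, the latter with the help of the immersion property.\<close>

locale immersed_patch =
  fixes G :: "real^'m::finite \<Rightarrow> real^'m^'m" and x :: "real^'n::finite \<Rightarrow> real^'m"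
    and V :: "(real^'m) set" and U :: "(real^'n) set"
  assumes open_V: "open V" and open_U: "open U" and x_in: "u \<in> U \<Longrightarrow> x u \<in> V"
    and diff2_G: "diff2_on V G" and diff2_x: "diff2_on U x"
    and sym: "z \<in> V \<Longrightarrow> transpose (G z) = G z"
    and pos: "z \<in> V \<Longrightarrow> v \<noteq> 0 \<Longrightarrow> v \<bullet> (G z *v v) > 0"
    and immersion: "u \<in> U \<Longrightarrow> inj (frechet_derivative x (at u))"
begin

abbreviation "ip u \<equiv> metric_inner (G (x u))"
abbreviation "e \<equiv> tangent_frame x"
abbreviation "g \<equiv> induced_metric G x"
abbreviation "pt \<equiv> push_tangent x"
abbreviation "tp \<equiv> tangential_part G x"

text \<open>The connection form of the ambient connection, pulled back along \<open>x\<close>.\<close>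

definition conn :: "'n \<Rightarrow> real^'n \<Rightarrow> real^'m^'m" where
  "conn a u = (\<chi> i k. \<Sum>j\<in>UNIV. christoffel G i j k (x u) * e a u $ j)"

text \<open>The covariant derivative along the a-th coordinate field in the pulled-back tangent
  bundle. It acts on whole vectors, unlike the componentwise \<open>ambient_deriv\<close>, so the
  bilinear product rules apply directly.\<close>

definition cov :: "'n \<Rightarrow> (real^'n \<Rightarrow> real^'m) \<Rightarrow> real^'n \<Rightarrow> real^'m" where
  "cov a W u = partial a W u + conn a u *v W u"

text \<open>Cartan's formula for the curvature of the connection form \<open>conn\<close>, evaluated
  on a pair of coordinate fields.\<close>

definition curv :: "'n \<Rightarrow> 'n \<Rightarrow> real^'n \<Rightarrow> real^'m^'m" where
  "curv a b u = partial a (conn b) u - partial b (conn a) u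
    + (conn a u ** conn b u - conn b u ** conn a u)"

lemma det_G: "z \<in> V \<Longrightarrow> det (G z) \<noteq> 0"
  using det_pos_if_pos_def[OF pos] by fastforce

lemma ip_commute: "u \<in> U \<Longrightarrow> ip u v w = ip u w v"
  by (simp add: metric_inner_commute sym x_in)

lemma ip_pos: "u \<in> U \<Longrightarrow> v \<noteq> 0 \<Longrightarrow> ip u v v > 0"
  by (simp add: metric_inner_eq pos x_in)

lemma x_differentiable: "u \<in> U \<Longrightarrow> x differentiable (at u)"
  using diff2_x by (simp add: diff2_on_def)

lemma e_eq: "u \<in> U \<Longrightarrow> e a u = partial a x u"
  by (simp add: tangent_frame_def vec_eq_iff partial_component x_differentiable)

lemma differentiable_e: "u \<in> U \<Longrightarrow> e a differentiable (at u)"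
  by (rule differentiable_cong_open[where f = "partial a x", OF _ open_U])
    (use diff2_x in \<open>auto simp: e_eq diff2_on_def\<close>)

lemma differentiable_Gx: "u \<in> U \<Longrightarrow> (\<lambda>v. G (x v)) differentiable (at u)"
  using diff2_G x_in by (intro differentiable_compose_at[of x u G]) (auto simp: x_differentiable diff2_on_def)

lemma differentiable_ip:
  assumes "u \<in> U" "W1 differentiable (at u)" "W2 differentiable (at u)"
  shows "(\<lambda>v. ip v (W1 v) (W2 v)) differentiable (at u)"
  unfolding metric_inner_eq
  using assms by (intro differentiable_inner differentiable_matrix_vector_mult differentiable_Gx)

lemma differentiable_conn: "u \<in> U \<Longrightarrow> conn a differentiable (at u)"
  unfolding conn_def[abs_def]
proof (intro differentiable_vecI, simp, intro differentiable_sum differentiable_mult ballI)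
  fix i j k assume u: "u \<in> U"
  show "(\<lambda>v. e a v $ j) differentiable (at u)"
    using u by (intro differentiable_component differentiable_e)
  show "(\<lambda>v. christoffel G i j k (x v)) differentiable (at u)"
    using u by (intro differentiable_compose_at[of x u "christoffel G i j k"] x_differentiable
        differentiable_christoffel[OF open_V _ diff2_G det_G] x_in)
qed simp

lemma differentiable_cov:
  assumes "u \<in> U" "diff2_on U W"
  shows "cov a W differentiable (at u)"
  unfolding cov_def[abs_def] using assms
  by (intro differentiable_add differentiable_matrix_vector_mult differentiable_conn) (auto simp: diff2_on_def)

lemma cov_add:
  "W1 differentiable (at u) \<Longrightarrow> W2 differentiable (at u) \<Longrightarrow>
    cov a (\<lambda>v. W1 v + W2 v) u = cov a W1 u + cov a W2 u"
  by (simp add: cov_def partial_add matrix_vector_right_distrib)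

lemma cov_uminus: "W differentiable (at u) \<Longrightarrow> cov a (\<lambda>v. - W v) u = - cov a W u"
  using partial_uminus[of W u a] by (simp add: cov_def matrix_vector_mult_def vec_eq_iff sum_negf)

lemma cov_cong: "u \<in> U \<Longrightarrow> (\<And>v. v \<in> U \<Longrightarrow> W1 v = W2 v) \<Longrightarrow> cov a W1 u = cov a W2 u"
  using partial_cong[OF open_U, of u W1 W2 a] by (simp add: cov_def)

lemma ambient_deriv_eq:
  assumes "W differentiable (at u)"
  shows "ambient_deriv G x (\<lambda>_. axis a 1) W u = cov a W u"
proof -
  have "(\<Sum>j\<in>UNIV. \<Sum>k\<in>UNIV. christoffel G i j k (x u) * partial a (\<lambda>v. x v $ j) u * W u $ k)
      = (conn a u *v W u) $ i" for i
    unfolding conn_def matrix_vector_mult_def tangent_frame_def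
    by (subst sum.swap) (simp add: sum_distrib_right)
  then show ?thesis
    using assms by (simp add: ambient_deriv_def cov_def vec_eq_iff axis_def partial_component
        if_distrib[of "\<lambda>y. y * _"] cong: if_cong)
qed

text \<open>Metric compatibility: \<open>G ** conn\<close> consists of symbols of the first kind
  contracted with the tangent vector. Adding the transpose cancels four of the six metric
  derivatives, and the other two make up the derivative of the metric along that vector.\<close>

lemma partial_Gx:
  assumes u: "u \<in> U"
  shows "partial a (\<lambda>v. G (x v)) u = G (x u) ** conn a u + transpose (G (x u) ** conn a u)"
proof -
  let ?D = "\<lambda>j p k. partial j (\<lambda>y. G y $ p $ k) (x u)"
  have G_diff: "G differentiable (at (x u))"
    using diff2_G x_in[OF u] by (simp add: diff2_on_def)
  have Dsym: "?D j p k = ?D j k p" for j p k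
    by (rule partial_cong[OF open_V x_in[OF u]]) (simp add: symmetric_matrix_nth sym)
  have D: "partial j G (x u) $ p $ k = ?D j p k" for j p k
    using G_diff by (simp add: partial_component differentiable_component)
  have L: "(G (x u) ** conn a u) $ p $ k = (\<Sum>j\<in>UNIV. e a u $ j * (1/2 * (?D j p k + ?D k p j - ?D p j k)))"
    for p k
  proof -
    have "(G (x u) ** conn a u) $ p $ k = (\<Sum>j\<in>UNIV. e a u $ j * (\<Sum>i\<in>UNIV. G (x u) $ p $ i * christoffel G i j k (x u)))"
      unfolding matrix_matrix_mult_def conn_def vec_lambda_beta sum_distrib_left
      by (subst sum.swap) (simp add: mult_ac)
    then show ?thesis by (simp only: christoffel_lower[of G "x u", OF det_G[OF x_in[OF u]]])
  qed
  show ?thesis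
  proof (simp only: vec_eq_iff, intro allI)
    fix p k
    have "partial a (\<lambda>v. G (x v)) u $ p $ k = (\<Sum>j\<in>UNIV. e a u $ j * ?D j p k)"
      using u by (simp add: partial_compose[OF x_differentiable G_diff] D e_eq)
    also have "\<dots> = (G (x u) ** conn a u) $ p $ k + (G (x u) ** conn a u) $ k $ p"
      unfolding L sum.distrib[symmetric]
    proof (intro sum.cong refl)
      fix j
      show "e a u $ j * ?D j p k = e a u $ j * (1/2 * (?D j p k + ?D k p j - ?D p j k))
          + e a u $ j * (1/2 * (?D j k p + ?D p k j - ?D k j p))"
        by (simp add: Dsym[of j k p] Dsym[of p k j] Dsym[of k j p] algebra_simps)
    qed
    finally show "partial a (\<lambda>v. G (x v)) u $ p $ k
        = (G (x u) ** conn a u + transpose (G (x u) ** conn a u)) $ p $ k"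
      by (simp add: transpose_def)
  qed
qed

lemma partial_ip:
  assumes u: "u \<in> U" and W: "W1 differentiable (at u)" "W2 differentiable (at u)"
  shows "partial a (\<lambda>v. ip v (W1 v) (W2 v)) u = ip u (cov a W1 u) (W2 u) + ip u (W1 u) (cov a W2 u)"
proof -
  have "(\<lambda>v. G (x v) *v W2 v) differentiable (at u)"
    using W differentiable_Gx[OF u] by (intro differentiable_matrix_vector_mult)
  then have "partial a (\<lambda>v. ip v (W1 v) (W2 v)) u
    = partial a W1 u \<bullet> (G (x u) *v W2 u) + W1 u \<bullet> (partial a (\<lambda>v. G (x v)) u *v W2 u + G (x u) *v partial a W2 u)"
    using W differentiable_Gx[OF u]
    by (simp add: metric_inner_eq partial_inner partial_matrix_vector_mult)
  moreover have "W1 u \<bullet> (transpose (G (x u) ** conn a u) *v W2 u) = (conn a u *v W1 u) \<bullet> (G (x u) *v W2 u)"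
    using inner_transpose_mult[of "conn a u *v W1 u" "G (x u)" "W2 u"] sym[OF x_in[OF u]]
    by (simp only: inner_transpose_mult matrix_vector_mul_assoc)
  ultimately show ?thesis
    by (simp add: partial_Gx[OF u] metric_inner_eq cov_def inner_add_left inner_add_right
        matrix_vector_right_distrib matrix_vector_mult_add_rdistrib matrix_vector_mul_assoc)
qed

text \<open>The ambient connection has no torsion: second derivatives of \<open>x\<close> commute
  and the Christoffel symbols are symmetric in their lower indices.\<close>

lemma cov_e_commute:
  assumes u: "u \<in> U"
  shows "cov a (e b) u = cov b (e a) u"
proof -
  have "partial a (e b) u = partial a (partial b x) u" for a b
    by (rule partial_cong[OF open_U u]) (simp add: e_eq)
  then have "partial a (e b) u = partial b (e a) u"
    using partial_commute_vec[OF open_U u diff2_x] by simp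
  moreover have "conn a u *v e b u = conn b u *v e a u"
  proof (simp only: vec_eq_iff, intro allI)
    fix i
    have "(conn a u *v e b u) $ i = (\<Sum>k\<in>UNIV. \<Sum>j\<in>UNIV. christoffel G i j k (x u) * e a u $ j * e b u $ k)"
      by (simp add: conn_def matrix_vector_mult_def sum_distrib_right)
    also have "\<dots> = (\<Sum>j\<in>UNIV. \<Sum>k\<in>UNIV. christoffel G i k j (x u) * e a u $ j * e b u $ k)"
      by (subst sum.swap) (simp add: christoffel_commute[of V "x u" G i, OF open_V x_in[OF u] sym])
    also have "\<dots> = (conn b u *v e a u) $ i"
      by (simp add: conn_def matrix_vector_mult_def sum_distrib_left sum_distrib_right mult_ac)
    finally show "(conn a u *v e b u) $ i = (conn b u *v e a u) $ i" .
  qed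
  ultimately show ?thesis by (simp add: cov_def)
qed

text \<open>Second derivatives of \<open>W\<close> commute, and the terms in which
  \<open>conn\<close> meets a first derivative of \<open>W\<close> are symmetric in a and b. Only
  terms algebraic in \<open>W u\<close> survive.\<close>

lemma cov_cov_commutator:
  assumes u: "u \<in> U" and W: "diff2_on U W"
  shows "cov a (cov b W) u - cov b (cov a W) u = curv a b u *v W u"
proof -
  have "cov a (cov b W) u = partial a (partial b W) u
      + (partial a (conn b) u *v W u + conn b u *v partial a W u)
      + conn a u *v (partial b W u + conn b u *v W u)" for a b
  proof -
    have "partial a (\<lambda>v. partial b W v + conn b v *v W v) u = partial a (partial b W) u
      + (partial a (conn b) u *v W u + conn b u *v partial a W u)"
      using W u by (simp add: partial_add partial_matrix_vector_mult differentiable_conn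
          differentiable_matrix_vector_mult diff2_on_def)
    then show ?thesis by (simp add: cov_def[abs_def])
  qed
  then show ?thesis
    using partial_commute_vec[OF open_U u W, of a b]
    by (simp add: curv_def matrix_vector_right_distrib matrix_vector_mult_add_rdistrib
        matrix_vector_mult_diff_rdistrib matrix_vector_mul_assoc)
qed

section \<open>The induced metric and the tangential projection\<close>

lemma ip_pt_right: "ip u v (pt u t) = (\<Sum>a\<in>UNIV. t $ a * ip u v (e a u))"
  by (simp add: push_tangent_def metric_inner.sum_right metric_inner.scaleR_right)

lemma pt_linear: "linear (pt u)"
  by (simp add: linear_iff push_tangent_def scaleR_left_distrib sum.distrib scaleR_sum_right)

lemma g_sym: "u \<in> U \<Longrightarrow> transpose (g u) = g u"
  by (simp add: induced_metric_def transpose_def vec_eq_iff ip_commute)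

lemma ip_pt_e: "u \<in> U \<Longrightarrow> ip u (pt u t) (e c u) = (g u *v t) $ c"
  by (simp add: push_tangent_def metric_inner.sum_left metric_inner.scaleR_left induced_metric_def
      matrix_vector_mult_def ip_commute[of u "e c u"] mult.commute)

lemma ip_pt_pt: "u \<in> U \<Longrightarrow> ip u (pt u s) (pt u t) = t \<bullet> (g u *v s)"
  by (simp add: ip_pt_right ip_pt_e inner_vec_def)

lemma pt_eq_0:
  assumes "u \<in> U" "pt u t = 0"
  shows "t = 0"
proof -
  have "frechet_derivative x (at u) t = pt u t"
    by (subst basis_expansion[symmetric, of t], unfold scalar_mult_eq_scaleR,
      subst linear_sum[OF linear_frechet_derivative[OF x_differentiable[OF assms(1)]]])
      (simp add: push_tangent_def e_eq[OF assms(1)] partial_def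
        linear_cmul[OF linear_frechet_derivative[OF x_differentiable[OF assms(1)]]])
  also have "\<dots> = frechet_derivative x (at u) 0"
    using assms linear_0[OF linear_frechet_derivative[OF x_differentiable[OF assms(1)]]] by simp
  finally show ?thesis
    using immersion[OF assms(1)] by (simp add: inj_eq)
qed

lemma det_g_pos: "u \<in> U \<Longrightarrow> det (g u) > 0"
proof (rule det_pos_if_pos_def)
  fix t :: "real^'n" assume "u \<in> U" "t \<noteq> 0"
  then show "t \<bullet> (g u *v t) > 0"
    using ip_pos[of u "pt u t"] pt_eq_0[of u t] by (auto simp: ip_pt_pt)
qed

lemma is_normal_diff_pt:
  "u \<in> U \<Longrightarrow> is_normal G x u (v - pt u t) \<longleftrightarrow> g u *v t = (\<chi> c. ip u v (e c u))"
  by (auto simp: is_normal_def metric_inner.diff_left ip_pt_e vec_eq_iff)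

lemma g_eq_iff:
  assumes "u \<in> U"
  shows "g u *v t = w \<longleftrightarrow> t = matrix_inv (g u) *v w"
  using matrix_inv_works[of "g u"] det_g_pos[OF assms]
  by (metis less_irrefl matrix_vector_mul_assoc matrix_vector_mul_lid)

text \<open>Normality of the remainder is a linear system whose matrix is the induced metric. Its
  invertibility gives exactly one solution, so the definite description in
  \<open>tangential_part\<close> denotes it.\<close>

lemma tp_eq_iff: "u \<in> U \<Longrightarrow> tp u v = t \<longleftrightarrow> is_normal G x u (v - pt u t)"
  unfolding tangential_part_def by (simp add: is_normal_diff_pt g_eq_iff) auto

lemma tp_eq: "u \<in> U \<Longrightarrow> tp u v = matrix_inv (g u) *v (\<chi> c. ip u v (e c u))"
  by (simp add: tp_eq_iff is_normal_diff_pt g_eq_iff)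

lemma tp_linear:
  assumes "u \<in> U"
  shows "linear (tp u)"
proof -
  have "(\<chi> c. ip u (v + w) (e c u)) = (\<chi> c. ip u v (e c u)) + (\<chi> c. ip u w (e c u))"
    "(\<chi> c. ip u (k *\<^sub>R v) (e c u)) = k *\<^sub>R (\<chi> c. ip u v (e c u))" for v w k
    by (simp_all add: vec_eq_iff metric_inner.add_left metric_inner.scaleR_left)
  then show ?thesis
    by (simp add: linear_iff tp_eq[OF assms] matrix_vector_right_distrib matrix_vector_mult_scaleR)
qed

lemma is_normal_minus_tp: "u \<in> U \<Longrightarrow> is_normal G x u (v - pt u (tp u v))"
  using tp_eq_iff by blast

lemma tp_cong_ip:
  "u \<in> U \<Longrightarrow> (\<And>c. ip u v (e c u) = ip u w (e c u)) \<Longrightarrow> tp u v = tp u w"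
  by (simp add: tp_eq)

lemma differentiable_tp:
  assumes "u \<in> U" "W differentiable (at u)"
  shows "(\<lambda>v. tp v (W v)) differentiable (at u)"
proof -
  have gd: "g differentiable (at u)"
    unfolding induced_metric_def[abs_def]
    by (intro differentiable_vecI, simp, intro differentiable_ip differentiable_e assms)
  have "(\<lambda>v. matrix_inv (g v) *v (\<chi> c. ip v (W v) (e c v))) differentiable (at u)"
  proof (intro differentiable_matrix_vector_mult)
    show "(\<lambda>v. matrix_inv (g v)) differentiable (at u)"
      by (rule differentiable_matrix_inv[OF gd open_U assms(1)]) (use det_g_pos in fastforce)
    show "(\<lambda>v. \<chi> c. ip v (W v) (e c v)) differentiable (at u)"
      by (intro differentiable_vecI, simp, intro differentiable_ip differentiable_e assms)
  qed
  then show ?thesis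
    by (rule differentiable_cong_open[OF _ open_U assms(1)]) (simp add: tp_eq)
qed

section \<open>The induced connection as the tangential part of the ambient one\<close>

lemma differentiable_pt:
  "u \<in> U \<Longrightarrow> T differentiable (at u) \<Longrightarrow> (\<lambda>v. pt v (T v)) differentiable (at u)"
  unfolding push_tangent_def
  by (intro differentiable_sum ballI differentiable_scaleR differentiable_component differentiable_e) auto

lemma partial_g:
  assumes u: "u \<in> U"
  shows "partial a (\<lambda>v. g v $ b $ c) u = ip u (cov a (e b) u) (e c u) + ip u (cov a (e c) u) (e b u)"
  using partial_ip[OF u differentiable_e[OF u] differentiable_e[OF u], of a b c]
  by (simp add: induced_metric_def ip_commute[OF u])

text \<open>Koszul's argument: the three derivatives of the induced metric give six inner products.
  By \<open>cov_e_commute\<close> four of them cancel and the other two agree, which the factor 1/2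
  compensates.\<close>

lemma christoffel_g_lower:
  assumes u: "u \<in> U"
  shows "(\<Sum>d\<in>UNIV. g u $ c $ d * christoffel g d a b u) = ip u (cov a (e b) u) (e c u)"
proof -
  have "det (g u) \<noteq> 0" using det_g_pos[OF u] by simp
  from christoffel_lower[of g u c a b, OF this] show ?thesis
    using cov_e_commute[OF u] by (simp add: partial_g[OF u] cov_e_commute[OF u, of c])
qed

lemma levi_civita_axis:
  "levi_civita h (\<lambda>_. axis a 1) T u $ c
    = partial a (\<lambda>v. T v $ c) u + (\<Sum>b\<in>UNIV. christoffel h c a b u * T u $ b)"
  by (simp add: levi_civita_def axis_def if_distrib[of "\<lambda>y. y * _"] cong: if_cong)

text \<open>The inner products with each \<open>e c\<close> agree: differentiating the components of
  \<open>T\<close> produces entries of the induced metric, and differentiating the frame produces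
  its lowered Christoffel symbols.\<close>

lemma gauss_formula:
  assumes u: "u \<in> U" and T: "T differentiable (at u)"
  shows "tp u (cov a (\<lambda>v. pt v (T v)) u) = levi_civita g (\<lambda>_. axis a 1) T u"
proof -
  let ?L = "levi_civita g (\<lambda>_. axis a 1) T u"
  have Tc: "(\<lambda>v. T v $ b) differentiable (at u)" for b
    using T by (rule differentiable_component)
  have "partial a (\<lambda>v. pt v (T v)) u
      = (\<Sum>b\<in>UNIV. partial a (\<lambda>v. T v $ b) u *\<^sub>R e b u + T u $ b *\<^sub>R partial a (e b) u)"
    unfolding push_tangent_def
    by (simp add: partial_sum partial_scaleR Tc differentiable_e[OF u] differentiable_scaleR)
  then have cov: "cov a (\<lambda>v. pt v (T v)) u
      = (\<Sum>b\<in>UNIV. partial a (\<lambda>v. T v $ b) u *\<^sub>R e b u + T u $ b *\<^sub>R cov a (e b) u)"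
    by (simp add: cov_def push_tangent_def scaleR_add_right sum.distrib
        bounded_bilinear.sum_right[OF bounded_bilinear_matrix_vector_mult]
        bounded_bilinear.scaleR_right[OF bounded_bilinear_matrix_vector_mult])
  have "ip u (cov a (\<lambda>v. pt v (T v)) u) (e c u) = (g u *v ?L) $ c" for c
  proof -
    have "(g u *v ?L) $ c = (\<Sum>d\<in>UNIV. g u $ c $ d * partial a (\<lambda>v. T v $ d) u)
        + (\<Sum>d\<in>UNIV. \<Sum>b\<in>UNIV. g u $ c $ d * christoffel g d a b u * T u $ b)"
      by (simp add: matrix_vector_mult_def levi_civita_axis distrib_left sum.distrib sum_distrib_left mult.assoc)
    also have "\<dots> = (\<Sum>d\<in>UNIV. g u $ c $ d * partial a (\<lambda>v. T v $ d) u)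
        + (\<Sum>b\<in>UNIV. ip u (cov a (e b) u) (e c u) * T u $ b)"
      unfolding christoffel_g_lower[OF u, symmetric] sum_distrib_right
      by (subst sum.swap) (rule refl)
    also have "\<dots> = ip u (cov a (\<lambda>v. pt v (T v)) u) (e c u)"
      by (simp add: cov metric_inner.sum_left metric_inner.add_left metric_inner.scaleR_left sum.distrib
          induced_metric_def ip_commute[OF u, of "e c u"] mult.commute)
    finally show ?thesis by simp
  qed
  then show ?thesis
    unfolding tp_eq_iff[OF u] is_normal_diff_pt[OF u] by (simp add: vec_eq_iff)
qed

text \<open>Coordinate fields commute, so torsion-freeness takes this form. It removes the
  Weingarten images of covariant derivatives from \<open>curly_W\<close>.\<close>

lemma levi_civita_axis_commute:
  assumes u: "u \<in> U"
  shows "levi_civita g (\<lambda>_. axis a 1) (\<lambda>_. axis b 1) u = levi_civita g (\<lambda>_. axis b 1) (\<lambda>_. axis a 1) u"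
proof -
  have "levi_civita g (\<lambda>_. axis a 1) (\<lambda>_. axis b 1) u $ c = christoffel g c a b u" for a b c
    unfolding levi_civita_axis by (simp add: partial_const axis_def if_distrib cong: if_cong)
  then show ?thesis
    using christoffel_commute[of U u g _ a b, OF open_U u g_sym] by (simp add: vec_eq_iff)
qed

end

section \<open>The Codazzi equation\<close>

locale framed_patch = immersed_patch G x V U
  for G :: "real^'m::finite \<Rightarrow> real^'m^'m" and x :: "real^'n::finite \<Rightarrow> real^'m" and V U +
  fixes N :: "'p::finite \<Rightarrow> real^'n \<Rightarrow> real^'m"
  assumes dims: "CARD('m) = CARD('n) + CARD('p)"
    and diff2_N: "diff2_on U (N A)"
    and normal: "u \<in> U \<Longrightarrow> is_normal G x u (N A u)"
    and orthonormal: "u \<in> U \<Longrightarrow> metric_inner (G (x u)) (N A u) (N B u) = (if A = B then 1 else 0)"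
begin

lemma differentiable_N: "u \<in> U \<Longrightarrow> N A differentiable (at u)"
  using diff2_N by (simp add: diff2_on_def)

lemma ip_N_pt: "u \<in> U \<Longrightarrow> ip u (N A u) (pt u t) = 0"
  using normal by (simp add: ip_pt_right is_normal_def)

text \<open>The map is injective: pairing its value with \<open>N A\<close> recovers
  \<open>s $ A\<close>, and then the immersion property recovers \<open>t\<close>. Equality of
  dimensions makes it surjective.\<close>

lemma ex_frame_expansion:
  assumes u: "u \<in> U"
  obtains t s where "z = pt u t + (\<Sum>B\<in>UNIV. s $ B *\<^sub>R N B u)"
proof -
  let ?T = "\<lambda>(t, s). pt u t + (\<Sum>B\<in>UNIV. s $ B *\<^sub>R N B u) :: real^'m"
  have lin: "linear ?T"
    using pt_linear[of u] by (auto simp: linear_iff scaleR_left_distrib sum.distrib scaleR_sum_right scaleR_right_distrib)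
  have "p = 0" if "?T p = 0" for p
  proof -
    obtain t s where p: "p = (t, s)" by force
    have "s $ A = ip u (N A u) (?T p)" for A
      by (simp add: p metric_inner.add_right metric_inner.sum_right metric_inner.scaleR_right ip_N_pt[OF u]
          orthonormal[OF u] if_distrib cong: if_cong)
    then have "s $ A = 0" for A
      using that by (simp add: metric_inner.zero_right)
    then have "s = 0" by (simp add: vec_eq_iff)
    then show ?thesis
      using that pt_eq_0[OF u, of t] p by (simp add: zero_prod_def)
  qed
  then have inj: "inj ?T"
    using linear_injective_0[OF lin] by blast
  have "dim (range ?T) = DIM(real^'m)"
    using dim_image_eq[OF lin, of UNIV] inj dims by simp
  then have "span (range ?T) = UNIV"
    by (simp only: dim_eq_full)
  then have "range ?T = UNIV"
    using linear_subspace_image[OF lin subspace_UNIV] by (simp only: span_eq_iff[THEN iffD2])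
  then show ?thesis
    using that by (metis (mono_tags, lifting) UNIV_I imageE old.prod.exhaust split_conv)
qed

lemma normal_expansion:
  assumes u: "u \<in> U" and z: "is_normal G x u z"
  shows "z = (\<Sum>B\<in>UNIV. ip u z (N B u) *\<^sub>R N B u)"
proof -
  obtain t s where zs: "z = pt u t + (\<Sum>B\<in>UNIV. s $ B *\<^sub>R N B u)"
    using ex_frame_expansion[OF u] .
  have "ip u (\<Sum>B\<in>UNIV. s $ B *\<^sub>R N B u) (pt u t) = 0"
    by (simp add: metric_inner.sum_left metric_inner.scaleR_left ip_N_pt[OF u])
  moreover have "ip u z (pt u t) = 0"
    using z by (simp add: ip_pt_right is_normal_def)
  ultimately have "ip u (pt u t) (pt u t) = 0"
    by (simp add: zs metric_inner.add_left)
  then have "pt u t = 0" using ip_pos[OF u] by force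
  moreover have "ip u (pt u t) (N A u) = 0" for A
    using ip_N_pt[OF u] ip_commute[OF u] by simp
  then have "ip u z (N A u) = s $ A" for A
    by (simp add: zs metric_inner.add_left metric_inner.sum_left metric_inner.scaleR_left
        orthonormal[OF u] if_distrib cong: if_cong)
  ultimately show ?thesis using zs by simp
qed

abbreviation "wg A b u \<equiv> weingarten G x (N A) (\<lambda>_. axis b 1) u"
abbreviation "nc A b u \<equiv> normal_connection G x (\<lambda>_. axis b 1) (N A) u"

lemma wg_eq: "u \<in> U \<Longrightarrow> wg A b u = - tp u (cov b (N A) u)"
  by (simp add: weingarten_def ambient_deriv_eq differentiable_N)

lemma cov_N: "u \<in> U \<Longrightarrow> cov b (N A) u = - pt u (wg A b u) + nc A b u"
  by (simp add: wg_eq normal_connection_def ambient_deriv_eq differentiable_N linear_neg[OF pt_linear]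
      normal_part_def)

lemma nc_normal: "u \<in> U \<Longrightarrow> is_normal G x u (nc A b u)"
  by (simp add: normal_connection_def normal_part_def is_normal_minus_tp)

lemma differentiable_wg: "u \<in> U \<Longrightarrow> wg A b differentiable (at u)"
  by (rule differentiable_cong_open[OF _ open_U, where f = "\<lambda>v. - tp v (cov b (N A) v)"])
    (auto simp: wg_eq intro!: differentiable_minus differentiable_tp differentiable_cov diff2_N)

lemma differentiable_nc: "u \<in> U \<Longrightarrow> nc A b differentiable (at u)"
  by (rule differentiable_cong_open[OF _ open_U, where f = "\<lambda>v. cov b (N A) v + pt v (wg A b v)"])
    (auto simp: cov_N intro!: differentiable_add differentiable_cov diff2_N differentiable_pt differentiable_wg)

text \<open>Obtained by differentiating orthogonality to \<open>e c\<close>. The right-hand side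
  contains no derivative of \<open>Z\<close>, so the tangential part of the derivative of a normal
  field depends only on its value at the point.\<close>

lemma ip_cov_normal:
  assumes u: "u \<in> U" and Z: "Z differentiable (at u)" "\<And>v. v \<in> U \<Longrightarrow> is_normal G x v (Z v)"
  shows "ip u (cov a Z u) (e c u) = - ip u (Z u) (cov a (e c) u)"
proof -
  have "partial a (\<lambda>v. ip v (Z v) (e c v)) u = partial a (\<lambda>v. 0) u"
    by (rule partial_cong[OF open_U u]) (use Z in \<open>simp add: is_normal_def\<close>)
  then show ?thesis
    using partial_ip[OF u Z(1) differentiable_e[OF u], of a c] by (simp add: partial_const)
qed

lemma ip_nc:
  assumes u: "u \<in> U"
  shows "ip u (nc A b u) (N B u) = ip u (cov b (N A) u) (N B u)"
proof -
  have "ip u (pt u t) (N B u) = 0" for t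
    using ip_N_pt[OF u] ip_commute[OF u] by simp
  then show ?thesis
    by (simp add: cov_N[OF u] metric_inner.diff_left)
qed

lemma ip_nc_skew:
  assumes u: "u \<in> U"
  shows "ip u (nc A b u) (N B u) = - ip u (nc B b u) (N A u)"
proof -
  have "partial b (\<lambda>v. ip v (N A v) (N B v)) u = partial b (\<lambda>v. if A = B then 1 else 0 :: real) u"
    by (rule partial_cong[OF open_U u]) (simp add: orthonormal)
  then show ?thesis
    using partial_ip[OF u differentiable_N[OF u] differentiable_N[OF u], of b A B]
    by (simp add: partial_const ip_nc[OF u] ip_commute[OF u, of "N A u"])
qed

text \<open>By \<open>ip_cov_normal\<close>, a pointwise expansion of the normal field in the frame
  suffices and its coefficients are not differentiated. The minus sign of the Weingarten map is
  absorbed by skewness of the normal connection, which also gives the index order of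
  \<open>curly_W\<close>.\<close>

lemma tp_cov_nc:
  assumes u: "u \<in> U"
  shows "tp u (cov a (nc A b) u) = (\<Sum>B\<in>UNIV. ip u (nc B b u) (N A u) *\<^sub>R wg B a u)"
proof -
  have "ip u (cov a (nc A b) u) (e c u)
      = ip u (\<Sum>B\<in>UNIV. ip u (nc A b u) (N B u) *\<^sub>R cov a (N B) u) (e c u)" for c
  proof -
    have "ip u (cov a (nc A b) u) (e c u) = - ip u (nc A b u) (cov a (e c) u)"
      by (intro ip_cov_normal differentiable_nc nc_normal u)
    also have "\<dots> = - ip u (\<Sum>B\<in>UNIV. ip u (nc A b u) (N B u) *\<^sub>R N B u) (cov a (e c) u)"
      using normal_expansion[OF u, of "nc A b u"] nc_normal[OF u] by simp
    also have "\<dots> = ip u (\<Sum>B\<in>UNIV. ip u (nc A b u) (N B u) *\<^sub>R cov a (N B) u) (e c u)"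
      by (simp add: metric_inner.sum_left metric_inner.scaleR_left sum_negf
          ip_cov_normal[OF u differentiable_N[OF u] normal])
    finally show ?thesis .
  qed
  then have "tp u (cov a (nc A b) u) = tp u (\<Sum>B\<in>UNIV. ip u (nc A b u) (N B u) *\<^sub>R cov a (N B) u)"
    by (rule tp_cong_ip[OF u])
  also have "\<dots> = (\<Sum>B\<in>UNIV. ip u (nc A b u) (N B u) *\<^sub>R - wg B a u)"
    by (simp add: linear_sum[OF tp_linear[OF u]] linear_cmul[OF tp_linear[OF u]] wg_eq[OF u])
  also have "\<dots> = (\<Sum>B\<in>UNIV. ip u (nc B b u) (N A u) *\<^sub>R wg B a u)"
    by (simp add: ip_nc_skew[OF u, where A = A])
  finally show ?thesis .
qed

lemma tp_cov_cov_N: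
  assumes u: "u \<in> U"
  shows "tp u (cov a (cov b (N A)) u)
    = - levi_civita g (\<lambda>_. axis a 1) (wg A b) u + (\<Sum>B\<in>UNIV. ip u (nc B b u) (N A u) *\<^sub>R wg B a u)"
proof -
  have "cov a (cov b (N A)) u = cov a (\<lambda>v. - pt v (wg A b v) + nc A b v) u"
    by (rule cov_cong[OF u]) (simp add: cov_N)
  also have "\<dots> = - cov a (\<lambda>v. pt v (wg A b v)) u + cov a (nc A b) u"
    using u by (subst cov_add)
      (auto simp: cov_uminus[OF differentiable_pt[OF u differentiable_wg[OF u]]] intro!: differentiable_minus differentiable_pt differentiable_wg differentiable_nc)
  finally show ?thesis
    by (simp add: linear_add[OF tp_linear[OF u]] linear_neg[OF tp_linear[OF u]]
        gauss_formula[OF u differentiable_wg[OF u]] tp_cov_nc[OF u] linear_diff[OF tp_linear[OF u]])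
qed

text \<open>The curvature is the commutator of covariant derivatives. Splitting each
  \<open>cov b (N A)\<close> into tangential and normal parts, the former yields derivatives of the
  Weingarten maps by the Gauss formula and the latter the normal connection terms.\<close>

lemma codazzi:
  assumes u: "u \<in> U"
  shows "curly_W G x N A (\<lambda>_. axis a 1) (\<lambda>_. axis b 1) u = - tp u (curv a b u *v N A u)"
proof -
  have "weingarten G x (N A) (levi_civita g (\<lambda>_. axis a 1) (\<lambda>_. axis b 1)) u
      = weingarten G x (N A) (levi_civita g (\<lambda>_. axis b 1) (\<lambda>_. axis a 1)) u"
    by (simp add: weingarten_def ambient_deriv_def levi_civita_axis_commute[OF u, of a b])
  then show ?thesis
    unfolding cov_cov_commutator[OF u diff2_N, symmetric]
    by (simp add: curly_W_def deriv_weingarten_def linear_diff[OF tp_linear[OF u]] tp_cov_cov_N[OF u]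
        sum_subtractf)
qed

end

section \<open>Rearranging sums and contracting with the Levi-Civita symbol\<close>

lemma sum_swap_pairs:
  "(\<Sum>i\<in>A. \<Sum>j\<in>B. \<Sum>p\<in>C. \<Sum>q\<in>D. f i j p q) = (\<Sum>p\<in>C. \<Sum>q\<in>D. \<Sum>i\<in>A. \<Sum>j\<in>B. f i j p q)"
proof -
  have "(\<Sum>i\<in>A. \<Sum>j\<in>B. \<Sum>p\<in>C. \<Sum>q\<in>D. f i j p q) = (\<Sum>i\<in>A. \<Sum>p\<in>C. \<Sum>j\<in>B. \<Sum>q\<in>D. f i j p q)"
    by (rule sum.cong[OF refl], rule sum.swap)
  also have "\<dots> = (\<Sum>p\<in>C. \<Sum>i\<in>A. \<Sum>j\<in>B. \<Sum>q\<in>D. f i j p q)"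
    by (rule sum.swap)
  also have "\<dots> = (\<Sum>p\<in>C. \<Sum>i\<in>A. \<Sum>q\<in>D. \<Sum>j\<in>B. f i j p q)"
    by (rule sum.cong[OF refl], rule sum.cong[OF refl], rule sum.swap)
  also have "\<dots> = (\<Sum>p\<in>C. \<Sum>q\<in>D. \<Sum>i\<in>A. \<Sum>j\<in>B. f i j p q)"
    by (rule sum.cong[OF refl], rule sum.swap)
  finally show ?thesis .
qed

lemma sum_lists_prod2:
  fixes h :: "nat \<Rightarrow> 'a::finite \<Rightarrow> 'b::finite \<Rightarrow> real"
  shows "(\<Sum>I | length I = k. \<Sum>J | length J = k. \<Prod>l<k. h l (I ! l) (J ! l))
    = (\<Prod>l<k. \<Sum>i\<in>UNIV. \<Sum>j\<in>UNIV. h l i j)"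
  by (simp add: sum_lists_prod[where h = "\<lambda>l. h l (_ ! l)"]
      sum_lists_prod[where h = "\<lambda>l i. \<Sum>j\<in>UNIV. h l i j"])

lemma sum_skew:
  fixes S f :: "'a::finite \<Rightarrow> 'a \<Rightarrow> real"
  assumes "\<And>a b. S b a = - S a b"
  shows "(\<Sum>a\<in>UNIV. \<Sum>b\<in>UNIV. S a b * f b a) = - (\<Sum>a\<in>UNIV. \<Sum>b\<in>UNIV. S a b * f a b)"
  by (subst sum.swap) (subst assms, simp add: sum_negf)

lemma sum_skew_symmetric:
  fixes S f :: "'a::finite \<Rightarrow> 'a \<Rightarrow> real"
  assumes "\<And>a b. S b a = - S a b" "\<And>a b. f a b = f b a"
  shows "(\<Sum>a\<in>UNIV. \<Sum>b\<in>UNIV. S a b * f a b) = 0"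
  using sum_skew[of S f, OF assms(1)] by (simp add: assms(2)[symmetric])

text \<open>The functions \<open>fs\<close> enter \<open>curly_C\<close> and every bracket with two
  free slots only through these coefficients. Isolating them leaves a skew form in a and b, and the
  rest of the argument does not see \<open>fs\<close>.\<close>

definition eps_contraction ::
  "(real^'n::{finite,linorder} \<Rightarrow> real) list \<Rightarrow> 'n::{finite,linorder} \<Rightarrow> 'n \<Rightarrow> real^'n::{finite,linorder} \<Rightarrow> real" where
  "eps_contraction fs a b u = (\<Sum>as | length as = CARD('n) - 2.
      eps (a # b # as) * (\<Prod>k<CARD('n) - 2. partial (as ! k) (fs ! k) u))"

lemma eps_contraction_skew:
  assumes "CARD('n::{finite,linorder}) \<ge> 2"
  shows "eps_contraction fs b a u = - eps_contraction fs a (b::'n) u"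
  unfolding eps_contraction_def sum_negf[symmetric]
  by (intro sum.cong) (simp_all add: eps_swap[of _ a b] assms)

lemma nambu_eq:
  fixes u :: "real^'n::{finite,linorder}"
  assumes n: "CARD('n) \<ge> 2"
  shows "nambu \<rho> (h1 # h2 # fs) u = (1 / \<rho> u) * (\<Sum>a\<in>UNIV. \<Sum>b\<in>UNIV.
    eps_contraction fs a b u * (partial a h1 u * partial b h2 u))"
proof -
  obtain m where m: "CARD('n) = Suc (Suc m)"
    using n by (metis Suc_le_D numeral_2_eq_2 add_2_eq_Suc le_Suc_ex)
  show ?thesis
    unfolding nambu_def eps_contraction_def m
    by (simp add: sum_lists_Suc prod.lessThan_Suc_shift sum_distrib_left sum_distrib_right mult_ac del: prod.lessThan_Suc)
qed

section \<open>Nambu brackets of the coordinates\<close>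

locale nambu_patch = framed_patch G x V U N
  for G :: "real^'m::finite \<Rightarrow> real^'m^'m" and x :: "real^'n::{finite,linorder} \<Rightarrow> real^'m" and V U
    and N :: "'p::finite \<Rightarrow> real^'n::{finite,linorder} \<Rightarrow> real^'m" +
  fixes \<rho> :: "real^'n::{finite,linorder} \<Rightarrow> real"
  assumes two_le: "CARD('n) \<ge> 2"
begin

lemma P_tensor_eq:
  assumes "length J = CARD('n) - 1"
  shows "P_tensor x \<rho> i J u = (1 / (sqrt (fact (CARD('n) - 1)) * \<rho> u)) *
    (\<Sum>p | length p = CARD('n). eps p * e (p ! 0) u $ i * (\<Prod>l<CARD('n) - 1. e (p ! Suc l) u $ (J ! l)))"
proof -
  obtain m where m: "CARD('n) = Suc m"
    using two_le by (metis Suc_le_D numeral_2_eq_2)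
  have "partial (p ! k) (map (\<lambda>j v. x v $ j) (i # J) ! k) u = e (p ! k) u $ ((i # J) ! k)"
    if "k < Suc m" for p k
    using that assms m nth_map[of k "i # J" "\<lambda>j v. x v $ j"] by (simp add: tangent_frame_def)
  then have "(\<Prod>k<Suc m. partial (p ! k) (map (\<lambda>j v. x v $ j) (i # J) ! k) u)
      = e (p ! 0) u $ i * (\<Prod>l<m. e (p ! Suc l) u $ (J ! l))" for p
    by (simp add: prod.lessThan_Suc_shift del: prod.lessThan_Suc list.map)
  then show ?thesis
    unfolding P_tensor_def nambu_def m by (simp add: mult.assoc del: prod.lessThan_Suc list.map)
qed

text \<open>This is (n - 1)! times the cofactor of the induced metric at (a, b).\<close>

definition eps_eps :: "'n \<Rightarrow> 'n \<Rightarrow> real^'n::{finite,linorder} \<Rightarrow> real" where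
  "eps_eps a b u = (\<Sum>as | length as = CARD('n) - 1. \<Sum>bs | length bs = CARD('n) - 1.
    eps (a # as) * eps (b # bs) * (\<Prod>l<CARD('n) - 1. g u $ (as ! l) $ (bs ! l)))"

text \<open>Contracting the multi-indices with the ambient metric pairs tangent vectors slot by slot
  into entries of the induced metric; the first slots keep \<open>i\<close> and \<open>k\<close>.
  The two normalising square roots multiply to (n - 1)!.\<close>

lemma P2_up_eq:
  "P2_up G x \<rho> i k u = (1 / (fact (CARD('n) - 1) * (\<rho> u)\<^sup>2)) *
    (\<Sum>a\<in>UNIV. \<Sum>b\<in>UNIV. eps_eps a b u * e a u $ i * e b u $ k)"
proof -
  let ?L = "{I::'m list. length I = CARD('n) - 1}" and ?M = "{p::'n list. length p = CARD('n)}"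
  let ?c = "1 / (sqrt (fact (CARD('n) - 1)) * \<rho> u)"
  let ?A = "\<lambda>p J. \<Prod>l<CARD('n) - 1. e (p ! Suc l) u $ (J ! l)"
  let ?H = "\<lambda>I J. \<Prod>l<CARD('n) - 1. G (x u) $ (I ! l) $ (J ! l)"
  obtain m where m: "CARD('n) = Suc m"
    using two_le by (metis Suc_le_D numeral_2_eq_2)
  have c2: "?c * ?c = 1 / (fact (CARD('n) - 1) * (\<rho> u)\<^sup>2)"
    by (simp add: power2_eq_square mult_ac)
  have gram: "(\<Sum>I\<in>?L. \<Sum>J\<in>?L. ?A p I * ?A q J * ?H I J)
      = (\<Prod>l<CARD('n) - 1. g u $ (p ! Suc l) $ (q ! Suc l))" for p q
  proof -
    have "(\<Sum>I\<in>?L. \<Sum>J\<in>?L. ?A p I * ?A q J * ?H I J)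
      = (\<Sum>I\<in>?L. \<Sum>J\<in>?L. \<Prod>l<CARD('n) - 1.
          G (x u) $ (I ! l) $ (J ! l) * e (p ! Suc l) u $ (I ! l) * e (q ! Suc l) u $ (J ! l))"
      by (simp add: prod.distrib mult_ac)
    also have "\<dots> = (\<Prod>l<CARD('n) - 1. g u $ (p ! Suc l) $ (q ! Suc l))"
      by (simp only: sum_lists_prod2[where h = "\<lambda>l i j. G (x u) $ i $ j * e (p ! Suc l) u $ i * e (q ! Suc l) u $ j"]
          induced_metric_def metric_inner_def vec_lambda_beta)
    finally show ?thesis .
  qed
  have "P2_up G x \<rho> i k u = (\<Sum>I\<in>?L. \<Sum>J\<in>?L.
      (?c * (\<Sum>p\<in>?M. eps p * e (p ! 0) u $ i * ?A p I)) * (?c * (\<Sum>q\<in>?M. eps q * e (q ! 0) u $ k * ?A q J)) * ?H I J)"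
    unfolding P2_up_def by (intro sum.cong refl) (simp only: P_tensor_eq mem_Collect_eq)
  also have "\<dots> = (?c * ?c) * (\<Sum>I\<in>?L. \<Sum>J\<in>?L.
      (\<Sum>p\<in>?M. eps p * e (p ! 0) u $ i * ?A p I) * (\<Sum>q\<in>?M. eps q * e (q ! 0) u $ k * ?A q J) * ?H I J)"
    unfolding sum_distrib_left[where r = "?c * ?c"] by (intro sum.cong refl) (simp only: mult_ac)
  also have "\<dots> = (?c * ?c) * (\<Sum>I\<in>?L. \<Sum>J\<in>?L. \<Sum>p\<in>?M. \<Sum>q\<in>?M.
      eps p * eps q * e (p ! 0) u $ i * e (q ! 0) u $ k * (?A p I * ?A q J * ?H I J))"
    unfolding sum_product unfolding sum_distrib_right
    by (intro arg_cong[where f = "\<lambda>y. ?c * ?c * y"] sum.cong refl) (simp only: mult_ac)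
  also have "\<dots> = (?c * ?c) * (\<Sum>p\<in>?M. \<Sum>q\<in>?M. eps p * eps q * e (p ! 0) u $ i * e (q ! 0) u $ k *
      (\<Prod>l<CARD('n) - 1. g u $ (p ! Suc l) $ (q ! Suc l)))"
    by (subst sum_swap_pairs) (simp only: gram sum_distrib_left[symmetric])
  also have "(\<Sum>p\<in>?M. \<Sum>q\<in>?M. eps p * eps q * e (p ! 0) u $ i * e (q ! 0) u $ k *
      (\<Prod>l<CARD('n) - 1. g u $ (p ! Suc l) $ (q ! Suc l)))
    = (\<Sum>a\<in>UNIV. \<Sum>as | length as = CARD('n) - 1. \<Sum>b\<in>UNIV. \<Sum>bs | length bs = CARD('n) - 1.
        eps (a # as) * eps (b # bs) * e a u $ i * e b u $ k * (\<Prod>l<CARD('n) - 1. g u $ (as ! l) $ (bs ! l)))"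
    unfolding m by (simp add: sum_lists_Suc)
  also have "\<dots> = (\<Sum>a\<in>UNIV. \<Sum>b\<in>UNIV. \<Sum>as | length as = CARD('n) - 1. \<Sum>bs | length bs = CARD('n) - 1.
        eps (a # as) * eps (b # bs) * e a u $ i * e b u $ k * (\<Prod>l<CARD('n) - 1. g u $ (as ! l) $ (bs ! l)))"
    by (rule sum.cong[OF refl], rule sum.swap)
  also have "\<dots> = (\<Sum>a\<in>UNIV. \<Sum>b\<in>UNIV. eps_eps a b u * e a u $ i * e b u $ k)"
    unfolding eps_eps_def sum_distrib_right by (intro sum.cong refl) (simp only: mult_ac)
  finally show ?thesis
    by (simp only: c2)
qed

lemma P2_mixed_mult:
  assumes u: "u \<in> U"
  shows "(\<Sum>j\<in>UNIV. P2_mixed G x \<rho> i j u * v $ j) = (gamma_ratio G x \<rho> u)\<^sup>2 * pt u (tp u v) $ i"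
proof -
  let ?t = "tp u v" and ?c = "1 / (fact (CARD('n) - 1) * (\<rho> u)\<^sup>2)"
  \<comment> \<open>The vector enters only through its inner products with the frame, and these are
    the induced metric applied to its tangential part. The cofactors can therefore be contracted
    with the metric.\<close>
  have ipe: "ip u (e b u) v = (\<Sum>c\<in>UNIV. g u $ c $ b * ?t $ c)" for b
  proof -
    have "(g u *v ?t) $ b = ip u v (e b u)"
      using is_normal_minus_tp[OF u, of v] by (simp add: is_normal_diff_pt[OF u])
    then show ?thesis
      by (simp add: matrix_vector_mult_def ip_commute[OF u] symmetric_matrix_nth[OF g_sym[OF u], of b])
  qed
  have "(\<Sum>j\<in>UNIV. P2_mixed G x \<rho> i j u * v $ j) = (\<Sum>k\<in>UNIV. P2_up G x \<rho> i k u * (G (x u) *v v) $ k)"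
    unfolding P2_mixed_def matrix_vector_mult_def vec_lambda_beta sum_distrib_left sum_distrib_right
    by (subst sum.swap) (simp only: mult.assoc)
  also have "\<dots> = ?c * (\<Sum>k\<in>UNIV. \<Sum>a\<in>UNIV. \<Sum>b\<in>UNIV. e a u $ i * (eps_eps a b u * (e b u $ k * (G (x u) *v v) $ k)))"
    by (simp only: P2_up_eq sum_distrib_left sum_distrib_right mult_ac)
  also have "\<dots> = ?c * (\<Sum>a\<in>UNIV. e a u $ i * (\<Sum>b\<in>UNIV. eps_eps a b u * ip u (e b u) v))"
  proof -
    have "(\<Sum>k\<in>UNIV. \<Sum>a\<in>UNIV. \<Sum>b\<in>UNIV. e a u $ i * (eps_eps a b u * (e b u $ k * (G (x u) *v v) $ k)))
        = (\<Sum>a\<in>UNIV. \<Sum>k\<in>UNIV. \<Sum>b\<in>UNIV. e a u $ i * (eps_eps a b u * (e b u $ k * (G (x u) *v v) $ k)))"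
      by (rule sum.swap)
    also have "\<dots> = (\<Sum>a\<in>UNIV. \<Sum>b\<in>UNIV. \<Sum>k\<in>UNIV. e a u $ i * (eps_eps a b u * (e b u $ k * (G (x u) *v v) $ k)))"
      by (rule sum.cong[OF refl], rule sum.swap)
    finally show ?thesis
      by (simp add: metric_inner_eq inner_vec_def sum_distrib_left)
  qed
  also have "\<dots> = ?c * (\<Sum>a\<in>UNIV. e a u $ i * (\<Sum>c\<in>UNIV. ?t $ c * (\<Sum>b\<in>UNIV. eps_eps a b u * g u $ c $ b)))"
  proof -
    have "(\<Sum>b\<in>UNIV. eps_eps a b u * ip u (e b u) v)
        = (\<Sum>c\<in>UNIV. ?t $ c * (\<Sum>b\<in>UNIV. eps_eps a b u * g u $ c $ b))" for a
      unfolding ipe sum_distrib_left by (subst sum.swap) (simp only: mult_ac)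
    then show ?thesis by simp
  qed
  also have "\<dots> = ?c * (\<Sum>a\<in>UNIV. e a u $ i * (?t $ a * (fact (CARD('n) - 1) * det (g u))))"
    \<comment> \<open>Only the diagonal term \<open>c = a\<close> survives, with the factorial that
      the prefactor cancels in the next step.\<close>
    by (simp add: eps_eps_def cofactor_identity[of _ "g u", simplified] if_distrib cong: if_cong)
  also have "\<dots> = (det (g u) / (\<rho> u)\<^sup>2) * pt u ?t $ i"
    by (simp add: push_tangent_def sum_distrib_left sum_distrib_right mult_ac)
  also have "det (g u) / (\<rho> u)\<^sup>2 = (gamma_ratio G x \<rho> u)\<^sup>2"
    using det_g_pos[OF u] by (simp add: gamma_ratio_def power_divide)
  finally show ?thesis .
qed

section \<open>Curvature expressed by Nambu brackets\<close>

definition bracket_matrix :: "(real^'n::{finite,linorder} \<Rightarrow> real) list \<Rightarrow> real^'n::{finite,linorder} \<Rightarrow> real^'m^'m" where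
  "bracket_matrix fs u = (\<chi> j j'.
     (\<Sum>k\<in>UNIV. nambu \<rho> ((\<lambda>v. x v $ k) # (\<lambda>v. christoffel G j k j' (x v)) # fs) u)
     - (\<Sum>k\<in>UNIV. \<Sum>l\<in>UNIV. \<Sum>r\<in>UNIV. nambu \<rho> ((\<lambda>v. x v $ k) # (\<lambda>v. x v $ l) # fs) u *
         christoffel G r l j' (x u) * christoffel G j k r (x u)))"

lemma partial_conn:
  assumes u: "u \<in> U"
  shows "partial a (conn b) u $ j $ j' = (\<Sum>k\<in>UNIV.
    partial a (\<lambda>v. christoffel G j k j' (x v)) u * e b u $ k + christoffel G j k j' (x u) * partial a (e b) u $ k)"
proof -
  have Ge: "(\<lambda>v. christoffel G j k j' (x v)) differentiable (at u)" for k
    by (rule differentiable_compose_at[OF x_differentiable[OF u]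
          differentiable_christoffel[OF open_V x_in[OF u] diff2_G det_G]])
  have ee: "(\<lambda>v. e b v $ k) differentiable (at u)" for k
    using differentiable_e[OF u] by (rule differentiable_component)
  have "partial a (conn b) u $ j $ j' = partial a (\<lambda>v. conn b v $ j $ j') u"
    using differentiable_conn[OF u] by (simp add: partial_component differentiable_component)
  also have "\<dots> = (\<Sum>k\<in>UNIV. partial a (\<lambda>v. christoffel G j k j' (x v) * e b v $ k) u)"
    using Ge ee by (simp add: conn_def partial_sum differentiable_mult)
  also have "\<dots> = (\<Sum>k\<in>UNIV.
    partial a (\<lambda>v. christoffel G j k j' (x v)) u * e b u $ k + christoffel G j k j' (x u) * partial a (e b) u $ k)"
    using Ge ee by (simp add: partial_mult partial_component differentiable_e[OF u])
  finally show ?thesis .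
qed

text \<open>In the contracted curvature, the derivative of the pulled-back symbols gives the bracket
  of \<open>x $ k\<close> with them, and the product of connection forms gives the bracket of two
  coordinates.\<close>

lemma bracket_matrix_eq:
  assumes u: "u \<in> U"
  shows "bracket_matrix fs u = - ((1 / (2 * \<rho> u)) *\<^sub>R
    (\<Sum>a\<in>UNIV. \<Sum>b\<in>UNIV. eps_contraction fs a b u *\<^sub>R curv a b u))"
proof -
  let ?S = "\<lambda>a b. eps_contraction fs a b u"
  let ?Gam = "\<lambda>i j k. christoffel G i j k (x u)"
  let ?dG = "\<lambda>a j k j'. partial a (\<lambda>v. christoffel G j k j' (x v)) u"
  have skew: "?S b a = - ?S a b" for a b
    by (rule eps_contraction_skew[OF two_le])
  have px: "partial a (\<lambda>v. x v $ k) u = e a u $ k" for a k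
    by (simp add: tangent_frame_def)
  have dsym: "partial a (e b) u = partial b (e a) u" for a b
  proof -
    have "partial a (e b) u = partial a (partial b x) u" for a b
      by (rule partial_cong[OF open_U u]) (simp add: e_eq)
    then show ?thesis using partial_commute_vec[OF open_U u diff2_x] by simp
  qed
  have "(\<Sum>a\<in>UNIV. \<Sum>b\<in>UNIV. ?S a b *\<^sub>R curv a b u) $ j $ j' = - (2 * \<rho> u) * bracket_matrix fs u $ j $ j'"
    if "\<rho> u \<noteq> 0" for j j'
  proof -
    have nam: "\<rho> u * nambu \<rho> (h1 # h2 # fs) u = (\<Sum>a\<in>UNIV. \<Sum>b\<in>UNIV. ?S a b * (partial a h1 u * partial b h2 u))"
      for h1 h2
      using that by (simp add: nambu_eq[OF two_le])
    \<comment> \<open>Half of the curvature: \<open>curv a b\<close> is the difference of this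
      expression and the one with a and b exchanged, so the skew contraction doubles it.\<close>
    let ?C = "\<lambda>a b. partial a (conn b) u $ j $ j' + (conn a u ** conn b u) $ j $ j'"
    let ?quad = "\<lambda>a b. (conn a u ** conn b u) $ j $ j'"
    let ?D = "\<lambda>k. \<Sum>a\<in>UNIV. \<Sum>b\<in>UNIV. ?S a b * (e a u $ k * ?dG b j k j')"
    have "(\<Sum>a\<in>UNIV. \<Sum>b\<in>UNIV. ?S a b *\<^sub>R curv a b u) $ j $ j' = (\<Sum>a\<in>UNIV. \<Sum>b\<in>UNIV. ?S a b * (?C a b - ?C b a))"
      by (simp add: curv_def algebra_simps)
    also have "\<dots> = 2 * (\<Sum>a\<in>UNIV. \<Sum>b\<in>UNIV. ?S a b * ?C a b)"
      using sum_skew[of ?S ?C, OF skew] by (simp add: right_diff_distrib sum_subtractf)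
    also have "(\<Sum>a\<in>UNIV. \<Sum>b\<in>UNIV. ?S a b * ?C a b) = (\<Sum>a\<in>UNIV. \<Sum>b\<in>UNIV. ?S a b * (\<Sum>k\<in>UNIV. ?dG a j k j' * e b u $ k))
        + (\<Sum>a\<in>UNIV. \<Sum>b\<in>UNIV. ?S a b * (\<Sum>k\<in>UNIV. ?Gam j k j' * partial a (e b) u $ k))
        + (\<Sum>a\<in>UNIV. \<Sum>b\<in>UNIV. ?S a b * ?quad a b)"
      by (simp add: partial_conn[OF u] distrib_left sum.distrib)
    \<comment> \<open>Here the second derivatives of the embedding disappear, being symmetric in a
      and b.\<close>
    also have "(\<Sum>a\<in>UNIV. \<Sum>b\<in>UNIV. ?S a b * (\<Sum>k\<in>UNIV. ?Gam j k j' * partial a (e b) u $ k)) = 0"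
      by (rule sum_skew_symmetric[OF skew]) (simp add: dsym)
    \<comment> \<open>The derivative of the Christoffel symbol carries the first index of the
      contraction, while the bracket has it in the second slot. Exchanging a and b produces the
      minus sign.\<close>
    also have "(\<Sum>a\<in>UNIV. \<Sum>b\<in>UNIV. ?S a b * (\<Sum>k\<in>UNIV. ?dG a j k j' * e b u $ k)) = - (\<Sum>k\<in>UNIV. ?D k)"
    proof -
      have "(\<Sum>a\<in>UNIV. \<Sum>b\<in>UNIV. ?S a b * (\<Sum>k\<in>UNIV. ?dG a j k j' * e b u $ k))
          = - (\<Sum>a\<in>UNIV. \<Sum>b\<in>UNIV. ?S a b * (\<Sum>k\<in>UNIV. ?dG b j k j' * e a u $ k))"
        by (rule sum_skew[OF skew])
      also have "(\<Sum>a\<in>UNIV. \<Sum>b\<in>UNIV. ?S a b * (\<Sum>k\<in>UNIV. ?dG b j k j' * e a u $ k)) = (\<Sum>a\<in>UNIV. \<Sum>k\<in>UNIV. \<Sum>b\<in>UNIV. ?S a b * (e a u $ k * ?dG b j k j'))"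
        unfolding sum_distrib_left by (intro sum.cong refl) (subst sum.swap, simp only: mult_ac)
      also have "\<dots> = (\<Sum>k\<in>UNIV. ?D k)"
        by (rule sum.swap)
      finally show ?thesis .
    qed
    also have "(\<Sum>a\<in>UNIV. \<Sum>b\<in>UNIV. ?S a b * ?quad a b) = (\<Sum>k\<in>UNIV. \<Sum>l\<in>UNIV. \<Sum>r\<in>UNIV.
        (\<Sum>a\<in>UNIV. \<Sum>b\<in>UNIV. ?S a b * (e a u $ k * e b u $ l)) * ?Gam r l j' * ?Gam j k r)"
    proof -
      have "?quad a b = (\<Sum>k\<in>UNIV. \<Sum>l\<in>UNIV. e a u $ k * e b u $ l * (\<Sum>r\<in>UNIV. ?Gam r l j' * ?Gam j k r))" for a b
      proof -
        have "?quad a b = (\<Sum>r\<in>UNIV. \<Sum>k\<in>UNIV. \<Sum>l\<in>UNIV. e a u $ k * e b u $ l * (?Gam r l j' * ?Gam j k r))"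
          by (simp add: matrix_matrix_mult_def conn_def sum_product mult_ac)
        also have "\<dots> = (\<Sum>k\<in>UNIV. \<Sum>r\<in>UNIV. \<Sum>l\<in>UNIV. e a u $ k * e b u $ l * (?Gam r l j' * ?Gam j k r))"
          by (rule sum.swap)
        also have "\<dots> = (\<Sum>k\<in>UNIV. \<Sum>l\<in>UNIV. \<Sum>r\<in>UNIV. e a u $ k * e b u $ l * (?Gam r l j' * ?Gam j k r))"
          by (rule sum.cong[OF refl], rule sum.swap)
        finally show ?thesis by (simp only: sum_distrib_left)
      qed
      then have "(\<Sum>a\<in>UNIV. \<Sum>b\<in>UNIV. ?S a b * ?quad a b) = (\<Sum>a\<in>UNIV. \<Sum>b\<in>UNIV. \<Sum>k\<in>UNIV. \<Sum>l\<in>UNIV.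
          ?S a b * (e a u $ k * e b u $ l * (\<Sum>r\<in>UNIV. ?Gam r l j' * ?Gam j k r)))"
        by (simp only: sum_distrib_left)
      also have "\<dots> = (\<Sum>k\<in>UNIV. \<Sum>l\<in>UNIV. \<Sum>a\<in>UNIV. \<Sum>b\<in>UNIV.
          ?S a b * (e a u $ k * e b u $ l * (\<Sum>r\<in>UNIV. ?Gam r l j' * ?Gam j k r)))"
        by (rule sum_swap_pairs)
      also have "\<dots> = (\<Sum>k\<in>UNIV. \<Sum>l\<in>UNIV.
        (\<Sum>a\<in>UNIV. \<Sum>b\<in>UNIV. ?S a b * (e a u $ k * e b u $ l)) * (\<Sum>r\<in>UNIV. ?Gam r l j' * ?Gam j k r))"
        by (simp only: sum_distrib_right mult.assoc)
      finally show ?thesis by (simp only: sum_distrib_left mult.assoc)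
    qed
    also have "2 * (- (\<Sum>k\<in>UNIV. ?D k) + 0 + (\<Sum>k\<in>UNIV. \<Sum>l\<in>UNIV. \<Sum>r\<in>UNIV.
        (\<Sum>a\<in>UNIV. \<Sum>b\<in>UNIV. ?S a b * (e a u $ k * e b u $ l)) * ?Gam r l j' * ?Gam j k r))
        = - (2 * \<rho> u) * bracket_matrix fs u $ j $ j'"
    proof -
      have "\<rho> u * bracket_matrix fs u $ j $ j' = (\<Sum>k\<in>UNIV. ?D k) - (\<Sum>k\<in>UNIV. \<Sum>l\<in>UNIV. \<Sum>r\<in>UNIV.
        (\<Sum>a\<in>UNIV. \<Sum>b\<in>UNIV. ?S a b * (e a u $ k * e b u $ l)) * ?Gam r l j' * ?Gam j k r)"
        by (simp only: bracket_matrix_def vec_lambda_beta right_diff_distrib sum_distrib_left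
            mult.assoc[symmetric] nam px)
      then show ?thesis by (simp add: mult.assoc)
    qed
    finally show ?thesis .
  qed
  \<comment> \<open>Division by zero gives zero, so here both sides of the claim are zero.\<close>
  moreover have "bracket_matrix fs u = 0" if "\<rho> u = 0"
    using that by (simp add: bracket_matrix_def nambu_def vec_eq_iff)
  ultimately show ?thesis
    by (cases "\<rho> u = 0") (simp_all add: vec_eq_iff)
qed

text \<open>At a fixed point \<open>tp u\<close> is linear, so the contraction moves inside it. The
  minus signs of \<open>codazzi\<close> and \<open>bracket_matrix_eq\<close> cancel.\<close>

lemma curly_C_eq:
  assumes u: "u \<in> U"
  shows "curly_C G x N \<rho> A fs u = tp u (bracket_matrix fs u *v N A u)"
proof -
  have "curly_C G x N \<rho> A fs u = (1 / (2 * \<rho> u)) *\<^sub>R (\<Sum>a\<in>UNIV. \<Sum>b\<in>UNIV.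
      eps_contraction fs a b u *\<^sub>R - tp u (curv a b u *v N A u))"
    unfolding curly_C_def codazzi[OF u] eps_contraction_def scaleR_sum_left ..
  also have "\<dots> = tp u (- ((1 / (2 * \<rho> u)) *\<^sub>R (\<Sum>a\<in>UNIV. \<Sum>b\<in>UNIV.
      eps_contraction fs a b u *\<^sub>R (curv a b u *v N A u))))"
    by (simp add: linear_neg[OF tp_linear[OF u]] linear_cmul[OF tp_linear[OF u]]
        linear_sum[OF tp_linear[OF u]] sum_negf)
  also have "- ((1 / (2 * \<rho> u)) *\<^sub>R (\<Sum>a\<in>UNIV. \<Sum>b\<in>UNIV.
      eps_contraction fs a b u *\<^sub>R (curv a b u *v N A u))) = bracket_matrix fs u *v N A u"
    by (simp add: bracket_matrix_eq[OF u]
        bounded_bilinear.sum_left[OF bounded_bilinear_matrix_vector_mult]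
        bounded_bilinear.scaleR_left[OF bounded_bilinear_matrix_vector_mult]
        bounded_bilinear.minus_left[OF bounded_bilinear_matrix_vector_mult])
  finally show ?thesis .
qed

lemma gamma_curly_C:
  assumes u: "u \<in> U"
  shows "(gamma_ratio G x \<rho> u)\<^sup>2 *\<^sub>R pt u (curly_C G x N \<rho> A fs u)
    = (\<chi> i. \<Sum>j\<in>UNIV. \<Sum>j'\<in>UNIV. P2_mixed G x \<rho> i j u * bracket_matrix fs u $ j $ j' * N A u $ j')"
proof (simp only: vec_eq_iff vec_lambda_beta, intro allI)
  fix i
  show "((gamma_ratio G x \<rho> u)\<^sup>2 *\<^sub>R pt u (curly_C G x N \<rho> A fs u)) $ i
    = (\<Sum>j\<in>UNIV. \<Sum>j'\<in>UNIV. P2_mixed G x \<rho> i j u * bracket_matrix fs u $ j $ j' * N A u $ j')"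
    using P2_mixed_mult[OF u, of i "bracket_matrix fs u *v N A u"]
    by (simp add: curly_C_eq[OF u] matrix_vector_mult_def sum_distrib_left mult.assoc)
qed

end

section \<open>From charts of the manifolds to the coordinate computation\<close>

theorem theorem3p17:
  fixes M :: "'q topology" and \<A> :: "('q, 'm::finite) chart set"
    and gbar :: "('q, 'm) chart \<Rightarrow> real^'m \<Rightarrow> real^'m^'m"
    and S :: "'s topology" and \<B> :: "('s, 'n::{finite,linorder}) chart set"
    and \<iota> :: "'s \<Rightarrow> 'q"
    and c :: "('s, 'n) chart" and d :: "('q, 'm) chart"
    and N :: "'p::finite \<Rightarrow> real^'n::{finite,linorder} \<Rightarrow> real^'m"
    and \<rho> :: "real^'n::{finite,linorder} \<Rightarrow> real"
    and fs :: "('s \<Rightarrow> real) list"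
    and A :: 'p and u :: "real^'n::{finite,linorder}"
  assumes dims: "CARD('n) \<ge> 2" "CARD('m) = CARD('n) + CARD('p)"
    and ambient: "smooth_manifold M \<A>" "riemannian_metric \<A> gbar"
    and submanifold: "smooth_manifold S \<B>" "smooth_embedding S \<B> M \<A> \<iota>"
    and coordinates: "c \<in> \<B>" "d \<in> \<A>" "\<iota> ` fst c \<subseteq> fst d"
    and frame: "orthonormal_normal_frame (gbar d) (coord_rep c d \<iota>) (chart_image c) N"
    and density: "smooth_on (chart_image c) \<rho>" "\<forall>v\<in>chart_image c. \<rho> v \<noteq> 0"
    and funs: "length fs = CARD('n) - 2" "\<forall>f\<in>set fs. smooth_function \<B> f"
    and point: "u \<in> chart_image c"
  shows "let G = gbar d; x = coord_rep c d \<iota>;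
             fc = map (\<lambda>f. f \<circ> chart_inv c) fs;
             coordf = (\<lambda>k v. x v $ k);
             Gam = (\<lambda>i j k v. christoffel G i j k (x v));
             brf = (\<lambda>g1 g2. nambu \<rho> (g1 # g2 # fc) u)
         in (gamma_ratio G x \<rho> u)\<^sup>2 *\<^sub>R push_tangent x u (curly_C G x N \<rho> A fc u) =
            (\<chi> i. \<Sum>j\<in>UNIV. \<Sum>j'\<in>UNIV. P2_mixed G x \<rho> i j u *
               ((\<Sum>k\<in>UNIV. brf (coordf k) (Gam j k j'))
                - (\<Sum>k\<in>UNIV. \<Sum>l\<in>UNIV. \<Sum>r\<in>UNIV.
                     brf (coordf k) (coordf l) * Gam r l j' u * Gam j k r u))
               * N A u $ j')"
proof -
  let ?G = "gbar d" and ?x = "coord_rep c d \<iota>" and ?U = "chart_image c" and ?V = "chart_image d"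
  have charts: "is_chart S c" "is_chart M d"
    using ambient(1) submanifold(1) coordinates unfolding smooth_manifold_def by blast+
  \<comment> \<open>Since the chart domain is mapped into that of \<open>d\<close>, the embedding is
    represented on the whole chart image, not just on a part of it.\<close>
  have "snd c ` (fst c \<inter> \<iota> -` fst d) = ?U"
    using coordinates(3) unfolding chart_image_def by (intro arg_cong[where f = "(`) (snd c)"]) auto
  then have x: "smooth_on ?U ?x" "\<forall>v\<in>?U. inj (frechet_derivative ?x (at v))"
    using submanifold(2) coordinates(1,2) unfolding smooth_embedding_def Let_def by metis+
  have G: "smooth_on ?V ?G" "\<forall>z\<in>?V. transpose (?G z) = ?G z \<and> (\<forall>v. v \<noteq> 0 \<longrightarrow> v \<bullet> (?G z *v v) > 0)"
    using ambient(2) coordinates(2) unfolding riemannian_metric_def by blast+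
  have "inj_on (snd c) (fst c)"
  proof -
    have "inj_on (snd c) (topspace (subtopology S (fst c)))"
      using charts(1) homeomorphic_imp_injective_map unfolding is_chart_def by blast
    moreover have "topspace (subtopology S (fst c)) = fst c"
      using charts(1) by (auto simp: is_chart_def dest: openin_subset)
    ultimately show ?thesis by simp
  qed
  \<comment> \<open>Injectivity of the chart map makes \<open>chart_inv c\<close> a true inverse, so
    the representative takes values in the image of \<open>d\<close>.\<close>
  then have xV: "?x v \<in> ?V" if "v \<in> ?U" for v
    using that coordinates(3) unfolding chart_image_def coord_rep_def chart_inv_def
    by (auto simp: the_inv_into_f_f)
  interpret nambu_patch ?G ?x ?V ?U N \<rho>
  proof
    show "open ?U" "open ?V"
      using charts by (auto simp: is_chart_def)
    show "diff2_on ?U (N B)" for B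
      using frame by (auto simp: orthonormal_normal_frame_def intro: smooth_on_imp_diff2_on)
  qed (use x G xV frame dims in \<open>auto simp: orthonormal_normal_frame_def intro: smooth_on_imp_diff2_on\<close>)
  show ?thesis
    unfolding Let_def gamma_curly_C[OF point] bracket_matrix_def vec_lambda_beta ..
qed

end
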